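(* Let $m,d\ge 1$ be integers, let $\{\sigma^{\rm obs}_{a|x}\}_{a\in[d],\,x\in\{1,\dots,m\}}$ be an assemblage, and let $x^*\in\{1,\dots,m\}$. Let $\mathcal{R}^{\rm S}_{x^*}$ be the set of all assemblages $\{\sigma_{a|x}\}$ of the form $\sigma_{a|x}=\mathrm{Tr}_A[(M_{a|x}\otimes\mathbb{I}^B)\rho_{AB}]$ for all $a,x$, where $\rho_{AB}\succeq 0$, $\mathrm{Tr}(\rho_{AB})=1$, $\{M_{a|x}\}_{a}$ is a POVM on system $A$ for every $x$ (i.e. $M_{a|x}\succeq0$, $\sum_a M_{a|x}=\mathbb{I}^A$), and the compatibility structure of the measurements satisfies $\mathcal{C}_A\supseteq K_{1,m-1}(x^* )$. Then $$P^{\rm S}_{\rm guess}(x^* )<1\quad\Longleftrightarrow\quad \{\sigma^{\rm obs}_{a|x}\}\notin \mathcal{R}^{\rm S}_{x^*}.$$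
   Context: $[d]=\{0,\dots,d-1\}$. All Hilbert spaces are finite-dimensional; the dimension of $A$ in the definition of $\mathcal{R}^{\rm S}_{x^*}$ is arbitrary. An assemblage (with $m$ inputs and $d$ outputs) is a family of positive semidefinite operators $\sigma_{a|x}$ on Bob's Hilbert space, $a\in[d]$, $x\in\{1,\dots,m\}$, with $\sum_a\sigma_{a|x}=\sum_a\sigma_{a|x'}$ for all $x,x'$ and $\mathrm{Tr}\sum_a\sigma_{a|x}=1$. Guessing probability: $$P^{\rm S}_{\rm guess}(x^* )=\max_{\{\sigma^e_{a|x}\}}\sum_{e\in[d]}\mathrm{Tr}(\sigma^e_{a=e|x^*})$$ over families of operators $\{\sigma^e_{a|x}\}_{e,a\in[d],\,x}$ on Bob's space subject to $\sum_e\sigma^e_{a|x}=\sigma^{\rm obs}_{a|x}$ for all $a,x$; $\sum_a\sigma^e_{a|x}=\sum_a\sigma^e_{a|x'}$ for all $e,x,x'$; $\sigma^e_{a|x}\succeq0$ for all $a,x,e$. (Also written $P_g^{\rm S}(x^* )$.) Compatibility: a set of POVMs $\{M_{a|x}\}_{a}$, $x\in S$, is compatible if there are a POVM $\{G_\lambda\}$ and conditional probability distributions $p(a|x,\lambda)$ with $M_{a|x}=\sum_\lambda p(a|x,\lambda)G_\lambda$ for all $a$ and $x\in S$. The compatibility structure $\mathcal{C}_A$ of $m$ POVMs is the hypergraph on $\{1,\dots,m\}$ whose hyperedges are the compatible subsets. $K_{1,m-1}(x^* )$ is the star graph with centre $x^*$ and edges $\{x^*,x'\}$, $x'\ne x^*$;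 thus $\mathcal{C}_A\supseteq K_{1,m-1}(x^* )$ means that for each $x'\neq x^*$ the two POVMs $x^*$ and $x'$ are compatible. *)

theory Defs
  imports "Jordan_Normal_Form.Matrix"
begin

text \<open>
  A Hilbert space of dimension \<open>n\<close> is \<open>carrier_vec n\<close> over the complex numbers, and its operators
  are \<open>carrier_mat n n\<close>. A family \<open>\<sigma>\<^bsub>a|x\<^esub>\<close> is the function application \<open>\<sigma> a x\<close>, where only the
  values at outcomes \<open>a < d\<close> and inputs \<open>x \<in> {1..m}\<close> matter.
\<close>

text \<open>
  Matrices of unspecified dimension form no additive monoid, so sums of \<open>n \<times> n\<close> matrices are taken
  entrywise.
\<close>

definition mat_sum :: "nat \<Rightarrow> ('i \<Rightarrow> complex mat) \<Rightarrow> 'i set \<Rightarrow> complex mat" where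
  "mat_sum n f I = mat n n (\<lambda>(i, j). \<Sum>k\<in>I. f k $$ (i, j))"

definition mat_trace :: "complex mat \<Rightarrow> complex" where
  "mat_trace A = (\<Sum>i<dim_row A. A $$ (i, i))"

text \<open>
  The order on the complex numbers is that of \<open>Complex_Order\<close>: \<open>0 \<le> z\<close> says that \<open>z\<close> is real and
  nonnegative. The condition below therefore includes hermiticity of \<open>A\<close>.
\<close>

definition psd :: "nat \<Rightarrow> complex mat \<Rightarrow> bool" where
  "psd n A \<longleftrightarrow> A \<in> carrier_mat n n \<and> (\<forall>v\<in>carrier_vec n. 0 \<le> (A *\<^sub>v v) \<bullet>c v)"

text \<open>
  Kronecker product: the basis vector \<open>e\<^sub>k \<otimes> e\<^sub>i\<close> of \<open>A \<otimes> B\<close> has index \<open>k * dim B + i\<close>.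
\<close>

definition kron :: "complex mat \<Rightarrow> complex mat \<Rightarrow> complex mat" where
  "kron A B = mat (dim_row A * dim_row B) (dim_col A * dim_col B)
     (\<lambda>(i, j). A $$ (i div dim_row B, j div dim_col B) * B $$ (i mod dim_row B, j mod dim_col B))"

definition ptrace_fst :: "nat \<Rightarrow> nat \<Rightarrow> complex mat \<Rightarrow> complex mat" where
  "ptrace_fst nA nB X = mat nB nB (\<lambda>(i, j). \<Sum>k<nA. X $$ (k * nB + i, k * nB + j))"

definition povm :: "nat \<Rightarrow> 'i set \<Rightarrow> ('i \<Rightarrow> complex mat) \<Rightarrow> bool" where
  "povm n I M \<longleftrightarrow> (\<forall>a\<in>I. psd n (M a)) \<and> mat_sum n M I = 1\<^sub>m n"

definition assemblage :: "nat \<Rightarrow> nat \<Rightarrow> nat \<Rightarrow> (nat \<Rightarrow> nat \<Rightarrow> complex mat) \<Rightarrow> bool" where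
  "assemblage m d n \<sigma> \<longleftrightarrow>
     (\<forall>a<d. \<forall>x\<in>{1..m}. psd n (\<sigma> a x)) \<and>
     (\<forall>x\<in>{1..m}. \<forall>x'\<in>{1..m}.
        mat_sum n (\<lambda>a. \<sigma> a x) {..<d} = mat_sum n (\<lambda>a. \<sigma> a x') {..<d}) \<and>
     (\<forall>x\<in>{1..m}. mat_trace (mat_sum n (\<lambda>a. \<sigma> a x) {..<d}) = 1)"

text \<open>The argument order \<open>s e a x\<close> stands for \<open>\<sigma>\<^sup>e\<^bsub>a|x\<^esub>\<close>.\<close>

definition guess_feasible ::
  "nat \<Rightarrow> nat \<Rightarrow> nat \<Rightarrow> (nat \<Rightarrow> nat \<Rightarrow> complex mat) \<Rightarrow> (nat \<Rightarrow> nat \<Rightarrow> nat \<Rightarrow> complex mat) \<Rightarrow> bool" where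
  "guess_feasible m d n \<sigma> s \<longleftrightarrow>
     (\<forall>a<d. \<forall>x\<in>{1..m}. mat_sum n (\<lambda>e. s e a x) {..<d} = \<sigma> a x) \<and>
     (\<forall>e<d. \<forall>x\<in>{1..m}. \<forall>x'\<in>{1..m}.
        mat_sum n (\<lambda>a. s e a x) {..<d} = mat_sum n (\<lambda>a. s e a x') {..<d}) \<and>
     (\<forall>e<d. \<forall>a<d. \<forall>x\<in>{1..m}. psd n (s e a x))"

text \<open>
  The maximum of the objective over all feasible families. The operator \<open>Max\<close> is meaningful for
  finite sets only, whence \<open>GREATEST\<close>; the maximum exists because the feasible set is nonempty and
  compact whenever \<open>\<sigma>\<close> is an assemblage. The traces are real, being those of positive semidefinite
  operators.
\<close>

definition guess_prob :: "nat \<Rightarrow> nat \<Rightarrow> nat \<Rightarrow> (nat \<Rightarrow> nat \<Rightarrow> complex mat) \<Rightarrow> nat \<Rightarrow> real" where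
  "guess_prob m d n \<sigma> xstar =
     (GREATEST p. \<exists>s. guess_feasible m d n \<sigma> s \<and> p = (\<Sum>e<d. Re (mat_trace (s e e xstar))))"

text \<open>\<open>p a x l\<close> is the conditional probability \<open>p(a | x, l)\<close>.\<close>

definition compatible :: "nat \<Rightarrow> nat \<Rightarrow> (nat \<Rightarrow> nat \<Rightarrow> complex mat) \<Rightarrow> nat set \<Rightarrow> bool" where
  "compatible d n M S \<longleftrightarrow>
     (\<exists>(L::nat) G (p :: nat \<Rightarrow> nat \<Rightarrow> nat \<Rightarrow> real).
        povm n {..<L} G \<and>
        (\<forall>x\<in>S. \<forall>l<L. (\<forall>a<d. 0 \<le> p a x l) \<and> (\<Sum>a<d. p a x l) = 1) \<and>
        (\<forall>x\<in>S. \<forall>a<d. M a x = mat_sum n (\<lambda>l. complex_of_real (p a x l) \<cdot>\<^sub>m G l) {..<L}))"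

text \<open>Hypergraphs on the vertex set \<open>{1..m}\<close> are given by their sets of hyperedges.\<close>

definition compat_structure :: "nat \<Rightarrow> nat \<Rightarrow> nat \<Rightarrow> (nat \<Rightarrow> nat \<Rightarrow> complex mat) \<Rightarrow> nat set set" where
  "compat_structure m d n M = {S. S \<subseteq> {1..m} \<and> compatible d n M S}"

definition star_graph :: "nat \<Rightarrow> nat \<Rightarrow> nat set set" where
  "star_graph m xstar = {{xstar, x} | x. x \<in> {1..m} \<and> x \<noteq> xstar}"

definition star_assemblages ::
  "nat \<Rightarrow> nat \<Rightarrow> nat \<Rightarrow> nat \<Rightarrow> (nat \<Rightarrow> nat \<Rightarrow> complex mat) set" where
  "star_assemblages m d n xstar =
     {\<sigma>. assemblage m d n \<sigma> \<and>
        (\<exists>nA \<rho> M.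
           psd (nA * n) \<rho> \<and> mat_trace \<rho> = 1 \<and>
           (\<forall>x\<in>{1..m}. povm nA {..<d} (\<lambda>a. M a x)) \<and>
           star_graph m xstar \<subseteq> compat_structure m d nA M \<and>
           (\<forall>a<d. \<forall>x\<in>{1..m}. \<sigma> a x = ptrace_fst nA n (kron (M a x) (1\<^sub>m n) * \<rho>)))}"

end

(*
  A perfect guess at xstar forces the operators s e a xstar with a different from e to vanish, so
  that summing s e a x over a gives sigma e xstar for every x: the family s is a joint refinement
  of the inputs xstar and x. If R = V V* is Bob's reduced state and W inverts V on the support,
  then the transposes of the operators W (s e a x) W*, once completed to the identity, form a joint
  POVM for the two inputs, and the purification of R given by V turns it back into s. Conversely, a
  joint POVM for xstar and x steers Bob to a feasible family that guesses perfectly. The maximum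
  defining the guessing probability is attained by compactness, hence it is less than 1 unless some
  feasible family has value 1.
*)

theory Submission
  imports Defs "Jordan_Normal_Form.Schur_Decomposition" "HOL-Analysis.Function_Topology"
begin

section \<open>Positive semidefinite matrices\<close>

text \<open>The state \<open>R\<close> may be singular. Then \<open>W * R * mat_adjoint W\<close> is
  only a projection, and the missing part \<open>T\<close> must be given to some outcome without
  changing what Bob receives. This is harmless because \<open>V * T * mat_adjoint V\<close>
  vanishes, but both marginals must receive \<open>T\<close> consistently: a joint POVM carries it
  at the pair (0, 0), each single measurement at outcome 0. The star arises because the refinements
  for different inputs \<open>x\<close> share their marginal at the centre. One measurement for
  \<open>xstar\<close> therefore serves all edges, each edge has its own joint POVM, and nothing
  relates two leaves to each other. The transpose is the price of moving an operator from Alice's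
  factor to Bob's across an entangled vector. It preserves positivity and sums, hence also joint
  POVMs. Of the factorization only \<open>V * mat_adjoint V = R\<close> and an inverse on the
  support matter, so congruence by an invertible matrix does the work of a spectral
  decomposition.\<close>

lemma mat_adjoint_dims [simp]:
  "dim_row (mat_adjoint A) = dim_col A" "dim_col (mat_adjoint A) = dim_row A"
  by (simp_all add: mat_adjoint_def)

lemma mat_adjoint_carrier [simp]:
  assumes "A \<in> carrier_mat m n" shows "mat_adjoint A \<in> carrier_mat n m"
  by (rule carrier_matI) (use assms in simp_all)

lemma index_mat_adjoint [simp]:
  "i < dim_col A \<Longrightarrow> j < dim_row A \<Longrightarrow> mat_adjoint A $$ (i, j) = conjugate (A $$ (j, i))"
  by (simp add: mat_adjoint_def mat_of_rows_index)

lemma mat_adjoint_one [simp]: "mat_adjoint (1\<^sub>m n :: complex mat) = 1\<^sub>m n"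
  by (rule eq_matI) auto

lemma mult_mat_assoc_dim:
  fixes A B C :: "complex mat"
  assumes "dim_col A = dim_row B" "dim_col B = dim_row C"
  shows "A * B * C = A * (B * C)"
  by (rule assoc_mult_mat[of _ "dim_row A" "dim_col A" _ "dim_col B" _ "dim_col C"]) (use assms in auto)

lemma mult_mat_entry:
  assumes "A \<in> carrier_mat m n" "B \<in> carrier_mat n k" "i < m" "j < k"
  shows "(A * B) $$ (i, j) = (\<Sum>l<n. A $$ (i, l) * B $$ (l, j))"
  using assms by (simp add: scalar_prod_def atLeast0LessThan)

lemma mat_adjoint_mult:
  fixes A B :: "complex mat"
  assumes "dim_col A = dim_row B"
  shows "mat_adjoint (A * B) = mat_adjoint B * mat_adjoint A"
proof (rule eq_matI)
  define m n k where "m = dim_row A" and "n = dim_row B" and "k = dim_col B"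
  then have A: "A \<in> carrier_mat m n" and B: "B \<in> carrier_mat n k"
    using assms by auto
  fix i j
  assume "i < dim_row (mat_adjoint B * mat_adjoint A)" "j < dim_col (mat_adjoint B * mat_adjoint A)"
  then have ij: "i < k" "j < m" using A B by auto
  have "mat_adjoint (A * B) $$ (i, j) = cnj ((A * B) $$ (j, i))"
    using A B ij by (subst index_mat_adjoint) auto
  also have "\<dots> = (\<Sum>l<n. cnj (B $$ (l, i)) * cnj (A $$ (j, l)))"
    unfolding mult_mat_entry[OF A B ij(2,1)] by (simp add: mult.commute)
  also have "\<dots> = (\<Sum>l<n. mat_adjoint B $$ (i, l) * mat_adjoint A $$ (l, j))"
    using A B ij by (intro sum.cong refl) simp
  also have "\<dots> = (mat_adjoint B * mat_adjoint A) $$ (i, j)"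
    by (rule mult_mat_entry[symmetric]) (use A B ij in auto)
  finally show "mat_adjoint (A * B) $$ (i, j) = (mat_adjoint B * mat_adjoint A) $$ (i, j)" .
qed (use assms in auto)

lemma congruence_entry:
  fixes X A :: "complex mat"
  assumes "X \<in> carrier_mat m n" "A \<in> carrier_mat n n" "i < m" "j < m"
  shows "(X * A * mat_adjoint X) $$ (i, j)
    = (\<Sum>p<n. \<Sum>q<n. X $$ (i, p) * A $$ (p, q) * cnj (X $$ (j, q)))"
proof -
  have "(X * A * mat_adjoint X) $$ (i, j) = (\<Sum>q<n. (\<Sum>p<n. X $$ (i, p) * A $$ (p, q)) * cnj (X $$ (j, q)))"
    using assms mult_carrier_mat[OF assms(1,2)]
    by (subst mult_mat_entry[of _ m n _ m])
      (simp_all add: mult_mat_entry[of _ m n _ n] del: index_mult_mat)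
  also have "\<dots> = (\<Sum>p<n. \<Sum>q<n. X $$ (i, p) * A $$ (p, q) * cnj (X $$ (j, q)))"
    by (subst sum.swap) (simp add: sum_distrib_right)
  finally show ?thesis .
qed

lemma cscalar_mult_mat_vec:
  fixes A :: "complex mat"
  assumes "A \<in> carrier_mat n n" "v \<in> carrier_vec n"
  shows "(A *\<^sub>v v) \<bullet>c v = (\<Sum>i<n. \<Sum>j<n. cnj (v $ i) * A $$ (i, j) * v $ j)"
proof -
  have "(A *\<^sub>v v) \<bullet>c v = (\<Sum>i<n. (\<Sum>j<n. A $$ (i, j) * v $ j) * cnj (v $ i))"
    using assms by (auto simp: scalar_prod_def atLeast0LessThan intro!: sum.cong)
  also have "\<dots> = (\<Sum>i<n. \<Sum>j<n. cnj (v $ i) * A $$ (i, j) * v $ j)"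
    by (simp add: sum_distrib_left sum_distrib_right mult_ac)
  finally show ?thesis .
qed

section \<open>Positivity through test vectors\<close>

lemma psd_iff:
  "psd n A \<longleftrightarrow> A \<in> carrier_mat n n \<and>
     (\<forall>f::nat \<Rightarrow> complex. 0 \<le> (\<Sum>i<n. \<Sum>j<n. cnj (f i) * A $$ (i, j) * f j))"
proof -
  have "(\<forall>v\<in>carrier_vec n. 0 \<le> (A *\<^sub>v v) \<bullet>c v)
     \<longleftrightarrow> (\<forall>f::nat \<Rightarrow> complex. 0 \<le> (\<Sum>i<n. \<Sum>j<n. cnj (f i) * A $$ (i, j) * f j))"
    if A: "A \<in> carrier_mat n n"
  proof (intro iffI allI ballI)
    fix f :: "nat \<Rightarrow> complex"
    assume "\<forall>v\<in>carrier_vec n. 0 \<le> (A *\<^sub>v v) \<bullet>c v"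
    then have "0 \<le> (A *\<^sub>v vec n f) \<bullet>c vec n f" by simp
    then show "0 \<le> (\<Sum>i<n. \<Sum>j<n. cnj (f i) * A $$ (i, j) * f j)"
      by (simp add: cscalar_mult_mat_vec[OF A])
  next
    fix v :: "complex vec"
    assume "\<forall>f::nat \<Rightarrow> complex. 0 \<le> (\<Sum>i<n. \<Sum>j<n. cnj (f i) * A $$ (i, j) * f j)"
      and "v \<in> carrier_vec n"
    then show "0 \<le> (A *\<^sub>v v) \<bullet>c v" by (simp add: cscalar_mult_mat_vec[OF A])
  qed
  then show ?thesis unfolding psd_def by blast
qed

lemma psd_carrier: "psd n A \<Longrightarrow> A \<in> carrier_mat n n"
  by (simp add: psd_def)

text \<open>Test vectors written as row matrices turn closure under congruence into associativity:
  testing \<open>X * A * mat_adjoint X\<close> on \<open>R\<close> is testing \<open>A\<close> on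
  \<open>R * X\<close>.\<close>

lemma psd_iff_row:
  "psd n A \<longleftrightarrow> A \<in> carrier_mat n n \<and>
     (\<forall>R\<in>carrier_mat 1 n. 0 \<le> (R * A * mat_adjoint R) $$ (0, 0))"
proof -
  have "(\<forall>f::nat \<Rightarrow> complex. 0 \<le> (\<Sum>i<n. \<Sum>j<n. cnj (f i) * A $$ (i, j) * f j))
     \<longleftrightarrow> (\<forall>R\<in>carrier_mat 1 n. 0 \<le> (R * A * mat_adjoint R) $$ (0, 0))"
    if A: "A \<in> carrier_mat n n"
  proof (intro iffI allI ballI)
    fix R :: "complex mat"
    assume *: "\<forall>f::nat \<Rightarrow> complex. 0 \<le> (\<Sum>i<n. \<Sum>j<n. cnj (f i) * A $$ (i, j) * f j)"
      and R: "R \<in> carrier_mat 1 n"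
    show "0 \<le> (R * A * mat_adjoint R) $$ (0, 0)"
      using *[rule_format, of "\<lambda>i. cnj (R $$ (0, i))"] congruence_entry[OF R A, of 0 0] by simp
  next
    fix f :: "nat \<Rightarrow> complex"
    assume *: "\<forall>R\<in>carrier_mat 1 n. 0 \<le> (R * A * mat_adjoint R) $$ (0, 0)"
    define R where "R = mat 1 n (\<lambda>(_, i). cnj (f i))"
    have R: "R \<in> carrier_mat 1 n" by (simp add: R_def)
    have "(R * A * mat_adjoint R) $$ (0, 0) = (\<Sum>i<n. \<Sum>j<n. cnj (f i) * A $$ (i, j) * f j)"
      using congruence_entry[OF R A, of 0 0] by (simp add: R_def)
    with * R show "0 \<le> (\<Sum>i<n. \<Sum>j<n. cnj (f i) * A $$ (i, j) * f j)" by metis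
  qed
  then show ?thesis unfolding psd_iff by blast
qed

lemma psd_congruence:
  assumes A: "psd n A" and X: "X \<in> carrier_mat m n"
  shows "psd m (X * A * mat_adjoint X)"
  unfolding psd_iff_row
proof (intro conjI ballI)
  note carr = psd_carrier[OF A]
  have X': "mat_adjoint X \<in> carrier_mat n m" using X by simp
  show "X * A * mat_adjoint X \<in> carrier_mat m m" by (intro mult_carrier_mat[OF _ X'] mult_carrier_mat[OF X carr])
  fix R :: "complex mat" assume R: "R \<in> carrier_mat 1 m"
  have "R * (X * A * mat_adjoint X) * mat_adjoint R = (R * X) * A * mat_adjoint (R * X)"
    using R X carr by (simp add: mult_mat_assoc_dim mat_adjoint_mult)
  also have "0 \<le> \<dots> $$ (0, 0)"
    using A mult_carrier_mat[OF R X] unfolding psd_iff_row by blast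
  finally show "0 \<le> (R * (X * A * mat_adjoint X) * mat_adjoint R) $$ (0, 0)" .
qed

lemma psd_one: "psd n (1\<^sub>m n)"
  unfolding psd_iff
proof (intro conjI allI)
  fix f :: "nat \<Rightarrow> complex"
  have "(\<Sum>i<n. \<Sum>j<n. cnj (f i) * 1\<^sub>m n $$ (i, j) * f j) = (\<Sum>i<n. cnj (f i) * f i)"
    by (intro sum.cong refl) (simp add: if_distrib[where f="\<lambda>x. _ * x * _"] cong: if_cong)
  also have "0 \<le> \<dots>" by (intro sum_nonneg) (simp add: less_eq_complex_def)
  finally show "0 \<le> (\<Sum>i<n. \<Sum>j<n. cnj (f i) * 1\<^sub>m n $$ (i, j) * f j)" .
qed auto

lemma psd_mult_adjoint:
  assumes "X \<in> carrier_mat m n" shows "psd m (X * mat_adjoint X)"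
  using psd_congruence[OF psd_one assms] unfolding right_mult_one_mat[OF assms] .

lemma psd_zero: "psd n (0\<^sub>m n n)"
  unfolding psd_iff by (intro conjI allI sum_nonneg) auto

lemma psd_mat_sum:
  assumes "\<And>k. k \<in> I \<Longrightarrow> psd n (f k)" shows "psd n (mat_sum n f I)"
  unfolding psd_iff
proof (intro conjI allI)
  show "mat_sum n f I \<in> carrier_mat n n" by (simp add: mat_sum_def)
  fix g :: "nat \<Rightarrow> complex"
  have "(\<Sum>i<n. \<Sum>j<n. cnj (g i) * mat_sum n f I $$ (i, j) * g j)
     = (\<Sum>i<n. \<Sum>j<n. \<Sum>k\<in>I. cnj (g i) * f k $$ (i, j) * g j)"
    by (simp add: mat_sum_def sum_distrib_left sum_distrib_right)
  also have "\<dots> = (\<Sum>k\<in>I. \<Sum>i<n. \<Sum>j<n. cnj (g i) * f k $$ (i, j) * g j)"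
    by (simp only: sum.swap[of _ I "{..<n}"])
  also have "0 \<le> \<dots>" by (rule sum_nonneg) (use assms psd_iff in blast)
  finally show "0 \<le> (\<Sum>i<n. \<Sum>j<n. cnj (g i) * mat_sum n f I $$ (i, j) * g j)" .
qed

text \<open>The form of the transpose at \<open>f\<close> is the form of \<open>A\<close> at the
  conjugate of \<open>f\<close>.\<close>

lemma psd_transpose:
  assumes "psd n A" shows "psd n (transpose_mat A)"
  unfolding psd_iff
proof (intro conjI allI)
  note carr = psd_carrier[OF assms]
  show "transpose_mat A \<in> carrier_mat n n" using carr by simp
  fix f :: "nat \<Rightarrow> complex"
  have "(\<Sum>i<n. \<Sum>j<n. cnj (f i) * transpose_mat A $$ (i, j) * f j)
     = (\<Sum>i<n. \<Sum>j<n. cnj (cnj (f j)) * A $$ (j, i) * cnj (f i))"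
    using carr by (intro sum.cong refl) (auto simp: mult_ac)
  also have "\<dots> = (\<Sum>j<n. \<Sum>i<n. cnj (cnj (f j)) * A $$ (j, i) * cnj (f i))" by (rule sum.swap)
  also have "0 \<le> \<dots>" using assms[unfolded psd_iff] by (elim conjE allE[where x = "\<lambda>i. cnj (f i)"]) simp
  finally show "0 \<le> (\<Sum>i<n. \<Sum>j<n. cnj (f i) * transpose_mat A $$ (i, j) * f j)" .
qed

section \<open>Principal blocks of size one and two\<close>

lemma psd_two_point:
  assumes A: "psd n A" and "i < n" "j < n" "i \<noteq> j"
  shows "0 \<le> cnj a * A $$ (i, i) * a + cnj a * A $$ (i, j) * b
    + (cnj b * A $$ (j, i) * a + cnj b * A $$ (j, j) * b)"
proof -
  define f where "f k = (if k = i then a else if k = j then b else 0)" for k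
  have 1: "(\<Sum>q<n. F q * f q) = F i * a + F j * b" for F
  proof -
    have "(\<Sum>q<n. F q * f q) = (\<Sum>q\<in>{i, j}. F q * f q)"
      by (rule sum.mono_neutral_right) (use assms in \<open>auto simp: f_def\<close>)
    then show ?thesis using assms by (simp add: f_def)
  qed
  have 2: "(\<Sum>p<n. cnj (f p) * F p) = cnj a * F i + cnj b * F j" for F
  proof -
    have "(\<Sum>p<n. cnj (f p) * F p) = (\<Sum>p\<in>{i, j}. cnj (f p) * F p)"
      by (rule sum.mono_neutral_right) (use assms in \<open>auto simp: f_def\<close>)
    then show ?thesis using assms by (simp add: f_def)
  qed
  have "(\<Sum>p<n. \<Sum>q<n. cnj (f p) * A $$ (p, q) * f q) 
      = cnj a * (A $$ (i, i) * a + A $$ (i, j) * b) + cnj b * (A $$ (j, i) * a + A $$ (j, j) * b)"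
    unfolding 1 by (subst 2[symmetric]) (simp add: algebra_simps)
  moreover have "0 \<le> (\<Sum>p<n. \<Sum>q<n. cnj (f p) * A $$ (p, q) * f q)"
    using A unfolding psd_iff by blast
  ultimately show ?thesis by (simp add: algebra_simps)
qed

lemma psd_diag_nonneg:
  assumes A: "psd n A" and "i < n" shows "0 \<le> A $$ (i, i)"
proof -
  define f :: "nat \<Rightarrow> complex" where "f k = of_bool (k = i)" for k
  have "(\<Sum>p<n. \<Sum>q<n. cnj (f p) * A $$ (p, q) * f q) = (\<Sum>p<n. cnj (f p) * A $$ (p, i))"
    using assms(2) by (intro sum.cong refl) (simp add: f_def of_bool_def if_distrib sum.delta cong: if_cong)
  also have "\<dots> = A $$ (i, i)"
    using assms(2) by (simp add: f_def of_bool_def if_distrib[where f = cnj] if_distribR sum.delta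
      if_distrib[where f = "\<lambda>x. x * _"] cong: if_cong)
  finally show ?thesis using A unfolding psd_iff by (elim conjE allE[where x = f]) simp
qed

lemma psd_hermitian:
  assumes A: "psd n A" and "i < n" "j < n" shows "A $$ (j, i) = cnj (A $$ (i, j))"
proof (cases "i = j")
  case True
  then show ?thesis using psd_diag_nonneg[OF A] assms
    by (simp add: less_eq_complex_def complex_eq_iff)
next
  case False
  note two = psd_two_point[OF A assms(2,3) False]
  have r: "Im (A $$ (i, i)) = 0" "Im (A $$ (j, j)) = 0"
    using psd_diag_nonneg[OF A] assms by (simp_all add: less_eq_complex_def)
  \<comment> \<open>The form is real at (1, 1), which makes the imaginary parts of the two entries
    opposite, and at (1, \<i>), which makes their real parts equal.\<close>
  show ?thesis using two[of 1 1] two[of 1 \<i>] r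
    by (simp add: less_eq_complex_def complex_eq_iff)
qed

lemma psd_zero_diag:
  assumes A: "psd n A" and "i < n" "j < n" and 0: "A $$ (i, i) = 0"
  shows "A $$ (i, j) = 0" "A $$ (j, i) = 0"
proof -
  show *: "A $$ (i, j) = 0"
  proof (rule ccontr)
    assume nz: "A $$ (i, j) \<noteq> 0"
    then have ij: "i \<noteq> j" using 0 by auto
    \<comment> \<open>On the vector with entry \<open>- s * z\<close> at \<open>i\<close> and 1 at
      \<open>j\<close> the form has the value \<open>b - 2 * s * (cmod z)\<^sup>2\<close>; the
      choice of \<open>s\<close> makes this -1.\<close>
    define z where "z = A $$ (i, j)"
    define b where "b = Re (A $$ (j, j))"
    define s where "s = (b + 1) / (2 * (cmod z)\<^sup>2)"
    have "0 \<le> Re (cnj (- s * z) * z + cnj z * (- s * z) + A $$ (j, j))"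
    proof -
      have "0 \<le> cnj (- s * z) * A $$ (i, i) * (- s * z) + cnj (- s * z) * A $$ (i, j) * 1
        + (cnj 1 * A $$ (j, i) * (- s * z) + cnj 1 * A $$ (j, j) * 1)"
        by (rule psd_two_point[OF A assms(2,3) ij])
      then show ?thesis
        unfolding 0 psd_hermitian[OF A assms(2,3)] z_def[symmetric]
        by (simp add: less_eq_complex_def algebra_simps)
    qed
    also have "\<dots> = b - 2 * s * ((Re z)\<^sup>2 + (Im z)\<^sup>2)"
      by (simp add: b_def power2_eq_square algebra_simps)
    also have "2 * s * ((Re z)\<^sup>2 + (Im z)\<^sup>2) = b + 1"
      using nz by (simp add: s_def z_def flip: cmod_power2)
    finally show False by simp
  qed
  then show "A $$ (j, i) = 0" using psd_hermitian[OF A assms(2,3)] by simp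
qed

section \<open>Diagonalization by congruence\<close>

text \<open>The matrix is an elementary shear, the identity plus \<open>u\<close> in column
  \<open>k\<close>: it adds \<open>u i\<close> times row \<open>k\<close> to row
  \<open>i\<close>.\<close>

lemma index_shear_mult:
  fixes u :: "nat \<Rightarrow> complex"
  assumes "i < n" "k < n"
  shows "(\<Sum>p<n. mat n n (\<lambda>(i, j). of_bool (i = j) + of_bool (j = k) * u i) $$ (i, p) * F p)
    = F i + u i * F k"
proof -
  have "(\<Sum>p<n. mat n n (\<lambda>(i, j). of_bool (i = j) + of_bool (j = k) * u i) $$ (i, p) * F p)
    = (\<Sum>p<n. (if i = p then F p else 0) + (if p = k then u i * F p else 0))"
    using assms by (intro sum.cong refl) (auto simp: algebra_simps)
  also have "\<dots> = F i + u i * F k" using assms by (simp add: sum.distrib)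
  finally show ?thesis .
qed

text \<open>If the pivot \<open>B $$ (k, k)\<close> vanishes, then so does its whole row and column, and the division
  by zero below makes the shear trivial.\<close>

lemma psd_elimination_step:
  assumes B: "psd n B" and k: "k < n"
    and diag: "\<And>i j. i < k \<Longrightarrow> j < n \<Longrightarrow> i \<noteq> j \<Longrightarrow> B $$ (i, j) = 0"
  obtains X Y where "X \<in> carrier_mat n n" "Y \<in> carrier_mat n n" "X * Y = 1\<^sub>m n" "Y * X = 1\<^sub>m n"
    "\<And>i j. i < Suc k \<Longrightarrow> j < n \<Longrightarrow> i \<noteq> j \<Longrightarrow> (X * B * mat_adjoint X) $$ (i, j) = 0"
proof -
  define u where "u i = (if i = k then 0 else - B $$ (i, k) / B $$ (k, k))" for i
  define S where "S w = mat n n (\<lambda>(i, j). of_bool (i = j) + of_bool (j = k) * w i)"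
    for w :: "nat \<Rightarrow> complex"
  have S: "S w \<in> carrier_mat n n" for w by (simp add: S_def)
  have row: "(\<Sum>p<n. S w $$ (i, p) * F p) = F i + w i * F k" if "i < n" for w i F
    unfolding S_def by (rule index_shear_mult[OF that k])
  have uk: "u k = 0" by (simp add: u_def)
  \<comment> \<open>As \<open>u k = 0\<close>, composing shears adds their vectors, so the shear by
    \<open>- u\<close> is the inverse.\<close>
  have inv: "S u * S (\<lambda>i. - u i) = 1\<^sub>m n" "S (\<lambda>i. - u i) * S u = 1\<^sub>m n"
    using k uk by (auto simp: mult_mat_entry[OF S S] row simp del: index_mult_mat(1) intro!: eq_matI)
      (auto simp: S_def)
  have entry: "(S u * B * mat_adjoint (S u)) $$ (i, j)
      = (B $$ (i, j) + cnj (u j) * B $$ (i, k)) + u i * (B $$ (k, j) + cnj (u j) * B $$ (k, k))"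
    if ij: "i < n" "j < n" for i j
  proof -
    have conj: "(\<Sum>q<n. G q * cnj (S u $$ (j, q))) = G j + cnj (u j) * G k" for G
    proof -
      have "(\<Sum>q<n. G q * cnj (S u $$ (j, q))) = cnj (\<Sum>q<n. S u $$ (j, q) * cnj (G q))"
        by (simp add: mult.commute)
      also have "\<dots> = G j + cnj (u j) * G k" by (simp add: row[OF ij(2)])
      finally show ?thesis .
    qed
    show ?thesis
      unfolding congruence_entry[OF S psd_carrier[OF B] ij] conj mult.assoc
        sum_distrib_left[symmetric]
      by (simp add: row[OF ij(1)] conj)
  qed
  have "(S u * B * mat_adjoint (S u)) $$ (i, j) = 0" if "i < Suc k" "j < n" "i \<noteq> j" for i j
  proof (cases "i = k")
    case True
    \<comment> \<open>The vector \<open>u\<close> is read off column \<open>k\<close>; Hermiticity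
      makes its conjugate clear row \<open>k\<close>.\<close>
    have "B $$ (k, j) + cnj (u j) * B $$ (k, k) = 0"
    proof (cases "B $$ (k, k) = 0")
      case True
      then show ?thesis using psd_zero_diag[OF B k that(2)] by simp
    next
      case False
      then show ?thesis
        using that True psd_hermitian[OF B k that(2)] psd_hermitian[OF B k k]
        by (simp add: u_def)
    qed
    then show ?thesis using True that k by (simp add: entry uk)
  next
    case False
    \<comment> \<open>A row cleared earlier has a zero in column \<open>k\<close>, hence
      \<open>u i = 0\<close> and the row does not change.\<close>
    then have "i < k" using that by simp
    then show ?thesis using that k diag by (simp add: entry u_def)
  qed
  then show thesis using that[OF S S inv] by blast
qed

text \<open>Symmetric Gaussian elimination, one pivot per row. The inverse \<open>Y\<close> is built
  alongside because the factor of \<open>A\<close> will be expressed through it.\<close>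

lemma psd_congruent_diagonal:
  assumes A: "psd n A"
  obtains X Y where "X \<in> carrier_mat n n" "Y \<in> carrier_mat n n" "X * Y = 1\<^sub>m n" "Y * X = 1\<^sub>m n"
    "\<And>i j. i < n \<Longrightarrow> j < n \<Longrightarrow> i \<noteq> j \<Longrightarrow> (X * A * mat_adjoint X) $$ (i, j) = 0"
proof -
  have "\<exists>X\<in>carrier_mat n n. \<exists>Y\<in>carrier_mat n n. X * Y = 1\<^sub>m n \<and> Y * X = 1\<^sub>m n \<and>
    (\<forall>i<k. \<forall>j<n. i \<noteq> j \<longrightarrow> (X * A * mat_adjoint X) $$ (i, j) = 0)" if "k \<le> n" for k
    using that
  proof (induction k)
    case 0
    then show ?case by (intro bexI[of _ "1\<^sub>m n"]) auto
  next
    case (Suc k)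
    then obtain X Y where X: "X \<in> carrier_mat n n" and Y: "Y \<in> carrier_mat n n"
      and XY: "X * Y = 1\<^sub>m n" and YX: "Y * X = 1\<^sub>m n"
      and 0: "\<forall>i<k. \<forall>j<n. i \<noteq> j \<longrightarrow> (X * A * mat_adjoint X) $$ (i, j) = 0"
      by (metis Suc_leD)
    obtain X' Y' where X': "X' \<in> carrier_mat n n" and Y': "Y' \<in> carrier_mat n n"
      and XY': "X' * Y' = 1\<^sub>m n" and YX': "Y' * X' = 1\<^sub>m n"
      and 1: "\<And>i j. i < Suc k \<Longrightarrow> j < n \<Longrightarrow> i \<noteq> j
        \<Longrightarrow> (X' * (X * A * mat_adjoint X) * mat_adjoint X') $$ (i, j) = 0"
      by (rule psd_elimination_step[OF psd_congruence[OF A X], of k]) (use Suc.prems 0 in auto)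
    have "X' * X * (Y * Y') = X' * (X * Y) * Y'"
      using X Y X' Y' by (simp add: mult_mat_assoc_dim)
    then have e1: "X' * X * (Y * Y') = 1\<^sub>m n" using X' XY XY' by simp
    have "Y * Y' * (X' * X) = Y * (Y' * X') * X"
      using X Y X' Y' by (simp add: mult_mat_assoc_dim)
    then have e2: "Y * Y' * (X' * X) = 1\<^sub>m n" using Y YX YX' by simp
    have "X' * X * A * mat_adjoint (X' * X) = X' * (X * A * mat_adjoint X) * mat_adjoint X'"
      using X X' psd_carrier[OF A] by (simp add: mult_mat_assoc_dim mat_adjoint_mult)
    then show ?case
      using mult_carrier_mat[OF X' X] mult_carrier_mat[OF Y Y'] e1 e2 1
      by (intro bexI[of _ "X' * X"] bexI[of _ "Y * Y'"]) auto
  qed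
  from this[OF order_refl] show thesis using that by blast
qed

section \<open>Factorization with an inverse on the support\<close>

lemma mat_adjoint_diag: "mat_adjoint (mat_diag n f) = mat_diag n (\<lambda>i. cnj (f i))"
  by (rule eq_matI) (auto simp: mat_diag_def)

lemma index_diag_mult_diag:
  fixes A :: "complex mat"
  assumes A: "A \<in> carrier_mat n n" and "i < n" "j < n"
  shows "(mat_diag n f * A * mat_diag n g) $$ (i, j) = f i * A $$ (i, j) * g j"
proof -
  have "mat_diag n f * A = mat n n (\<lambda>(i, j). f i * A $$ (i, j))"
    by (rule mat_diag_mult_left[OF A])
  moreover have "B * mat_diag n g = mat n n (\<lambda>(i, j). B $$ (i, j) * g j)" if "B \<in> carrier_mat n n" for B
    by (rule mat_diag_mult_right[OF that])
  ultimately show ?thesis using assms(2,3) by simp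
qed

text \<open>\<open>W\<close> is a one-sided inverse of \<open>V\<close> on the range of \<open>R\<close>, which contains the range of every
  \<open>S\<close> with \<open>0 \<le> S \<le> R\<close>.\<close>

lemma psd_factor_inverse:
  assumes R: "psd n R"
  obtains V W where "V \<in> carrier_mat n n" "W \<in> carrier_mat n n" "V * mat_adjoint V = R"
    "psd n (1\<^sub>m n - W * R * mat_adjoint W)"
    "\<And>S. psd n S \<Longrightarrow> psd n (R - S) \<Longrightarrow> V * (W * S * mat_adjoint W) * mat_adjoint V = S"
proof -
  note Rc = psd_carrier[OF R]
  obtain X Y where X: "X \<in> carrier_mat n n" and Y: "Y \<in> carrier_mat n n"
    and XY: "X * Y = 1\<^sub>m n" and YX: "Y * X = 1\<^sub>m n"
    and diag: "\<And>i j. i < n \<Longrightarrow> j < n \<Longrightarrow> i \<noteq> j \<Longrightarrow> (X * R * mat_adjoint X) $$ (i, j) = 0"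
    by (rule psd_congruent_diagonal[OF R]) blast
  define r where "r i = Re ((X * R * mat_adjoint X) $$ (i, i))" for i
  \<comment> \<open>The support of the diagonal form is marked by \<open>p\<close>. As
    \<open>1 / sqrt 0 = 0\<close>, the matrix \<open>E\<close> is the Moore-Penrose inverse of
    \<open>D\<close>. The factors will be \<open>Y * D\<close> for \<open>V\<close> and
    \<open>E * X\<close> for \<open>W\<close>.\<close>
  define p where "p i = (if r i = 0 then 0 else 1 :: complex)" for i
  define D where "D = mat_diag n (\<lambda>i. complex_of_real (sqrt (r i)))"
  define E where "E = mat_diag n (\<lambda>i. complex_of_real (1 / sqrt (r i)))"
  have DE: "D \<in> carrier_mat n n" "E \<in> carrier_mat n n" by (simp_all add: D_def E_def)
  have DE_adj: "mat_adjoint D = D" "mat_adjoint E = E" by (simp_all add: D_def E_def mat_adjoint_diag)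
  note XR = psd_congruence[OF R X]
  have r0: "0 \<le> r i" and rX: "(X * R * mat_adjoint X) $$ (i, i) = complex_of_real (r i)" if "i < n" for i
    using psd_diag_nonneg[OF XR that] by (auto simp: r_def less_eq_complex_def complex_eq_iff)
  have XRX: "X * R * mat_adjoint X = mat_diag n (\<lambda>i. complex_of_real (r i))"
    using psd_carrier[OF XR] diag rX by (intro eq_matI) (auto simp: mat_diag_def simp del: index_mult_mat(1))
  have DD: "D * D = mat_diag n (\<lambda>i. complex_of_real (r i))"
    unfolding D_def mat_diag_diag using r0
    by (intro eq_matI) (auto simp: mat_diag_def simp flip: of_real_mult)
  have DEp: "D * E = mat_diag n p"
    unfolding D_def E_def mat_diag_diag using r0
    by (intro eq_matI) (auto simp: mat_diag_def p_def simp flip: of_real_mult)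
  have EXE: "E * mat_diag n (\<lambda>i. complex_of_real (r i)) * E = mat_diag n p"
    unfolding E_def mat_diag_diag using r0
    by (intro eq_matI) (auto simp: mat_diag_def p_def simp flip: of_real_mult)
  have undo: "Y * (X * S * mat_adjoint X) * mat_adjoint Y = S" if S: "S \<in> carrier_mat n n" for S
  proof -
    have "Y * (X * S * mat_adjoint X) * mat_adjoint Y = (Y * X) * S * mat_adjoint (Y * X)"
      using X Y S by (simp add: mult_mat_assoc_dim mat_adjoint_mult)
    then show ?thesis using S by (simp add: YX)
  qed
  have 1: "(Y * D) * mat_adjoint (Y * D) = R"
  proof -
    have "(Y * D) * mat_adjoint (Y * D) = Y * (D * D) * mat_adjoint Y"
      using Y DE by (simp add: mult_mat_assoc_dim mat_adjoint_mult DE_adj)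
    then show ?thesis unfolding DD XRX[symmetric] undo[OF Rc] .
  qed
  have 2: "psd n (1\<^sub>m n - (E * X) * R * mat_adjoint (E * X))"
  proof -
    have "(E * X) * R * mat_adjoint (E * X) = E * (X * R * mat_adjoint X) * E"
      using X DE Rc by (simp add: mult_mat_assoc_dim mat_adjoint_mult DE_adj)
    then have *: "1\<^sub>m n - (E * X) * R * mat_adjoint (E * X) = mat_diag n (\<lambda>i. 1 - p i)"
      unfolding XRX EXE by (intro eq_matI) (auto simp: mat_diag_def)
    have "mat_diag n (\<lambda>i. 1 - p i) * mat_adjoint (mat_diag n (\<lambda>i. 1 - p i)) = mat_diag n (\<lambda>i. 1 - p i)"
      unfolding mat_adjoint_diag mat_diag_diag by (intro eq_matI) (auto simp: mat_diag_def p_def)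
    then show ?thesis using psd_mult_adjoint[of "mat_diag n (\<lambda>i. 1 - p i)" n n] * by simp
  qed
  have 3: "(Y * D) * ((E * X) * S * mat_adjoint (E * X)) * mat_adjoint (Y * D) = S"
    if S: "psd n S" and RS: "psd n (R - S)" for S
  proof -
    note Sc = psd_carrier[OF S]
    note XS = psd_congruence[OF S X]
    have RSX: "(X * R * mat_adjoint X) $$ (i, j)
        = (X * S * mat_adjoint X) $$ (i, j) + (X * (R - S) * mat_adjoint X) $$ (i, j)"
      if "i < n" "j < n" for i j
      unfolding congruence_entry[OF X Rc that] congruence_entry[OF X Sc that]
        congruence_entry[OF X psd_carrier[OF RS] that]
      using Sc Rc by (simp add: algebra_simps flip: sum.distrib)
    \<comment> \<open>Where the diagonal form of \<open>R\<close> vanishes, the nonnegative diagonal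
      entries coming from \<open>S\<close> and \<open>R - S\<close> add up to zero. A zero on the
      diagonal then clears the whole row and column, so compressing by \<open>p\<close> does not
      change \<open>X * S * mat_adjoint X\<close>.\<close>
    have zero: "(X * S * mat_adjoint X) $$ (i, i) = 0" if "i < n" "r i = 0" for i
    proof -
      have "0 \<le> (X * S * mat_adjoint X) $$ (i, i)" "0 \<le> (X * (R - S) * mat_adjoint X) $$ (i, i)"
        using psd_diag_nonneg[OF XS] psd_diag_nonneg[OF psd_congruence[OF RS X]] that by blast+
      moreover have "(X * S * mat_adjoint X) $$ (i, i) + (X * (R - S) * mat_adjoint X) $$ (i, i) = 0"
        using RSX[OF that(1,1)] rX[OF that(1)] that(2) by simp
      ultimately show ?thesis by (simp add: add_nonneg_eq_0_iff)
    qed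
    have "mat_diag n p * (X * S * mat_adjoint X) * mat_diag n p = X * S * mat_adjoint X"
    proof (rule eq_matI)
      fix i j assume "i < dim_row (X * S * mat_adjoint X)" "j < dim_col (X * S * mat_adjoint X)"
      then have ij: "i < n" "j < n" using X by auto
      have "(mat_diag n p * (X * S * mat_adjoint X) * mat_diag n p) $$ (i, j)
          = p i * (X * S * mat_adjoint X) $$ (i, j) * p j"
        by (rule index_diag_mult_diag[OF psd_carrier[OF XS] ij])
      also have "\<dots> = (X * S * mat_adjoint X) $$ (i, j)"
      proof (cases "r i = 0 \<or> r j = 0")
        case True
        then have "(X * S * mat_adjoint X) $$ (i, j) = 0"
          using psd_zero_diag(1)[OF XS ij zero] psd_zero_diag(2)[OF XS ij(2,1) zero] ij by blast
        then show ?thesis by (simp only: mult_zero_left mult_zero_right)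
      next
        case False
        then show ?thesis by (simp add: p_def del: index_mult_mat)
      qed
      finally show "(mat_diag n p * (X * S * mat_adjoint X) * mat_diag n p) $$ (i, j)
          = (X * S * mat_adjoint X) $$ (i, j)" .
    qed (use X in \<open>auto simp: mat_diag_def\<close>)
    moreover have "mat_diag n p = E * D"
      unfolding DEp[symmetric] D_def E_def mat_diag_diag by (simp add: mult.commute)
    ultimately have *: "(D * E) * (X * S * mat_adjoint X) * (E * D) = X * S * mat_adjoint X"
      unfolding DEp by simp
    have "(Y * D) * ((E * X) * S * mat_adjoint (E * X)) * mat_adjoint (Y * D)
        = Y * ((D * E) * (X * S * mat_adjoint X) * (E * D)) * mat_adjoint Y"
      using X Y DE Sc by (simp add: mult_mat_assoc_dim mat_adjoint_mult DE_adj)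
    then show ?thesis unfolding * undo[OF Sc] .
  qed
  show thesis
    by (rule that[OF mult_carrier_mat[OF Y DE(1)] mult_carrier_mat[OF DE(2) X] 1 2 3])
qed

lemma mat_sum_carrier [simp]: "mat_sum n f I \<in> carrier_mat n n"
  and mat_sum_dims [simp]: "dim_row (mat_sum n f I) = n" "dim_col (mat_sum n f I) = n"
  and index_mat_sum [simp]: "i < n \<Longrightarrow> j < n \<Longrightarrow> mat_sum n f I $$ (i, j) = (\<Sum>k\<in>I. f k $$ (i, j))"
  by (simp_all add: mat_sum_def)

lemma psd_factor:
  assumes "psd n A" obtains V where "V \<in> carrier_mat n n" "V * mat_adjoint V = A"
  by (rule psd_factor_inverse[OF assms]) (rule that)

lemma mult_adjoint_entry:
  fixes V :: "complex mat"
  assumes "V \<in> carrier_mat m n" "i < m" "j < m"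
  shows "(V * mat_adjoint V) $$ (i, j) = (\<Sum>k<n. V $$ (i, k) * cnj (V $$ (j, k)))"
  using assms by (subst mult_mat_entry[of _ m n _ m]) auto

section \<open>Trace bounds\<close>

lemma mat_trace_sum:
  "mat_trace (mat_sum n f I) = (\<Sum>k\<in>I. \<Sum>i<n. f k $$ (i, i))"
  unfolding mat_trace_def by (subst sum.swap) simp

lemma mat_trace_carrier: "A \<in> carrier_mat n n \<Longrightarrow> mat_trace A = (\<Sum>i<n. A $$ (i, i))"
  by (auto simp: mat_trace_def)

lemma psd_trace_nonneg:
  assumes "psd n A" shows "0 \<le> mat_trace A"
  unfolding mat_trace_carrier[OF psd_carrier[OF assms]]
  by (rule sum_nonneg) (use psd_diag_nonneg[OF assms] in simp)

lemma psd_trace_zero: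
  assumes A: "psd n A" and 0: "mat_trace A = 0" shows "A = 0\<^sub>m n n"
proof (rule eq_matI)
  fix i j assume "i < dim_row (0\<^sub>m n n)" "j < dim_col (0\<^sub>m n n)"
  then have ij: "i < n" "j < n" by auto
  have "A $$ (i, i) = 0"
    using 0 ij sum_nonneg_0[of "{..<n}" "\<lambda>i. A $$ (i, i)" i] psd_diag_nonneg[OF A]
    by (simp add: mat_trace_carrier[OF psd_carrier[OF A]])
  then show "A $$ (i, j) = 0\<^sub>m n n $$ (i, j)" using psd_zero_diag[OF A ij] ij by simp
qed (use psd_carrier[OF A] in auto)

text \<open>As a Gram matrix of the rows of \<open>V\<close>, \<open>A\<close> has inner products as
  entries, and the inequality of arithmetic and geometric means bounds each by the mean of two
  diagonal entries. This is what bounds the feasible families.\<close>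

lemma psd_entry_bound:
  assumes A: "psd n A" and ij: "i < n" "j < n"
  shows "cmod (A $$ (i, j)) \<le> Re (mat_trace A)"
proof -
  obtain V where V: "V \<in> carrier_mat n n" and VA: "V * mat_adjoint V = A"
    by (rule psd_factor[OF A])
  define s where "s i = (\<Sum>k<n. (cmod (V $$ (i, k)))\<^sup>2)" for i
  have s: "complex_of_real (s i) = A $$ (i, i)" if "i < n" for i
    unfolding VA[symmetric] mult_adjoint_entry[OF V that that] s_def
    by (simp add: complex_norm_square flip: of_real_power)
  have "Re (A $$ (i, i)) = s i" if "i < n" for i
    using s[OF that] by (metis Re_complex_of_real)
  then have trace: "Re (mat_trace A) = (\<Sum>i<n. s i)"
    by (simp add: mat_trace_carrier[OF psd_carrier[OF A]])
  have s_nonneg: "0 \<le> s i" for i by (simp add: s_def sum_nonneg)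
  have s_le: "s i \<le> Re (mat_trace A)" if "i < n" for i
    unfolding trace using that s_nonneg by (intro member_le_sum) auto
  have "cmod (A $$ (i, j)) \<le> (\<Sum>k<n. cmod (V $$ (i, k)) * cmod (V $$ (j, k)))"
    unfolding VA[symmetric] mult_adjoint_entry[OF V ij]
    by (rule order_trans[OF norm_sum]) (simp add: norm_mult)
  also have "\<dots> \<le> (\<Sum>k<n. ((cmod (V $$ (i, k)))\<^sup>2 + (cmod (V $$ (j, k)))\<^sup>2) / 2)"
  proof (rule sum_mono)
    fix k
    show "cmod (V $$ (i, k)) * cmod (V $$ (j, k))
        \<le> ((cmod (V $$ (i, k)))\<^sup>2 + (cmod (V $$ (j, k)))\<^sup>2) / 2"
      using sum_squares_bound[of "cmod (V $$ (i, k))" "cmod (V $$ (j, k))"] by simp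
  qed
  also have "\<dots> = (s i + s j) / 2"
    by (simp add: s_def sum.distrib sum_divide_distrib[symmetric])
  also have "\<dots> \<le> Re (mat_trace A)" using s_le[OF ij(1)] s_le[OF ij(2)] by simp
  finally show ?thesis .
qed

lemma congruence_mat_sum:
  assumes X: "X \<in> carrier_mat m n" and f: "\<And>k. k \<in> I \<Longrightarrow> f k \<in> carrier_mat n n"
  shows "X * mat_sum n f I * mat_adjoint X = mat_sum m (\<lambda>k. X * f k * mat_adjoint X) I"
proof (rule eq_matI)
  fix i j
  assume "i < dim_row (mat_sum m (\<lambda>k. X * f k * mat_adjoint X) I)"
    "j < dim_col (mat_sum m (\<lambda>k. X * f k * mat_adjoint X) I)"
  then have ij: "i < m" "j < m" by auto
  have "(X * mat_sum n f I * mat_adjoint X) $$ (i, j)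
      = (\<Sum>p<n. \<Sum>q<n. \<Sum>k\<in>I. X $$ (i, p) * f k $$ (p, q) * cnj (X $$ (j, q)))"
    by (simp add: congruence_entry[OF X _ ij] sum_distrib_left sum_distrib_right)
  also have "\<dots> = (\<Sum>k\<in>I. \<Sum>p<n. \<Sum>q<n. X $$ (i, p) * f k $$ (p, q) * cnj (X $$ (j, q)))"
    by (simp only: sum.swap[of _ I "{..<n}"])
  also have "\<dots> = mat_sum m (\<lambda>k. X * f k * mat_adjoint X) I $$ (i, j)"
    using ij by (simp add: congruence_entry[OF X f] del: index_mult_mat)
  finally show "(X * mat_sum n f I * mat_adjoint X) $$ (i, j)
    = mat_sum m (\<lambda>k. X * f k * mat_adjoint X) I $$ (i, j)" .
qed (use X in auto)

section \<open>Steering\<close>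

text \<open>Bob's unnormalized conditional state when Alice obtains the effect \<open>M\<close>.
  Linearity and positivity in \<open>M\<close> carry joint POVMs over to refinements of an
  assemblage.\<close>

definition steer :: "nat \<Rightarrow> nat \<Rightarrow> complex mat \<Rightarrow> complex mat \<Rightarrow> complex mat" where
  "steer nA n \<rho> M = ptrace_fst nA n (kron M (1\<^sub>m n) * \<rho>)"

text \<open>The splitting of indices behind \<open>kron\<close>, and later behind pairs of outcomes
  coded as \<open>e * d + a\<close>.\<close>

lemma sum_lessThan_mult:
  fixes f :: "nat \<Rightarrow> 'a::comm_monoid_add"
  shows "(\<Sum>q<a * b. f q) = (\<Sum>k<a. \<Sum>i<b. f (k * b + i))"
proof -
  have "sum f {k * b..<k * b + b} = (\<Sum>i<b. f (k * b + i))" for k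
    using sum.shift_bounds_nat_ivl[of f 0 "k * b" b]
    by (simp add: add.commute atLeast0LessThan)
  then show ?thesis by (simp flip: sum.nat_group)
qed

lemma steer_carrier [simp]: "steer nA n \<rho> M \<in> carrier_mat n n"
  and steer_dims [simp]: "dim_row (steer nA n \<rho> M) = n" "dim_col (steer nA n \<rho> M) = n"
  by (simp_all add: steer_def ptrace_fst_def)

lemma mult_add_less:
  assumes "k < a" "i < b" shows "k * b + i < a * (b::nat)"
proof -
  have "k * b + i < Suc k * b" using assms(2) by simp
  also have "\<dots> \<le> a * b" by (rule mult_le_mono1) (use assms(1) in simp)
  finally show ?thesis .
qed

lemma steer_entry:
  assumes M: "M \<in> carrier_mat nA nA" and \<rho>: "\<rho> \<in> carrier_mat (nA * n) (nA * n)"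
    and ij: "i < n" "j < n"
  shows "steer nA n \<rho> M $$ (i, j) = (\<Sum>k<nA. \<Sum>l<nA. M $$ (k, l) * \<rho> $$ (l * n + i, k * n + j))"
proof -
  have K: "kron M (1\<^sub>m n) \<in> carrier_mat (nA * n) (nA * n)" using M by (auto simp: kron_def)
  have "(kron M (1\<^sub>m n) * \<rho>) $$ (k * n + i, k * n + j)
      = (\<Sum>l<nA. M $$ (k, l) * \<rho> $$ (l * n + i, k * n + j))" if k: "k < nA" for k
  proof -
    have b: "k * n + i < nA * n" "k * n + j < nA * n" using k ij by (auto intro: mult_add_less)
    have "(kron M (1\<^sub>m n) * \<rho>) $$ (k * n + i, k * n + j)
        = (\<Sum>l<nA. \<Sum>p<n. kron M (1\<^sub>m n) $$ (k * n + i, l * n + p) * \<rho> $$ (l * n + p, k * n + j))"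
      unfolding mult_mat_entry[OF K \<rho> b] by (rule sum_lessThan_mult)
    also have "\<dots> = (\<Sum>l<nA. \<Sum>p<n. if p = i then M $$ (k, l) * \<rho> $$ (l * n + i, k * n + j) else 0)"
      using M ij b by (intro sum.cong refl) (auto simp: kron_def mult_add_less)
    also have "\<dots> = (\<Sum>l<nA. M $$ (k, l) * \<rho> $$ (l * n + i, k * n + j))" using ij by simp
    finally show ?thesis .
  qed
  then show ?thesis using ij by (simp add: steer_def ptrace_fst_def)
qed

lemma steer_mat_sum:
  assumes f: "\<And>k. k \<in> I \<Longrightarrow> f k \<in> carrier_mat nA nA" and \<rho>: "\<rho> \<in> carrier_mat (nA * n) (nA * n)"
  shows "steer nA n \<rho> (mat_sum nA f I) = mat_sum n (\<lambda>k. steer nA n \<rho> (f k)) I"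
proof (rule eq_matI)
  fix i j
  assume "i < dim_row (mat_sum n (\<lambda>k. steer nA n \<rho> (f k)) I)"
    "j < dim_col (mat_sum n (\<lambda>k. steer nA n \<rho> (f k)) I)"
  then have ij: "i < n" "j < n" by auto
  have "steer nA n \<rho> (mat_sum nA f I) $$ (i, j)
      = (\<Sum>k<nA. \<Sum>l<nA. \<Sum>c\<in>I. f c $$ (k, l) * \<rho> $$ (l * n + i, k * n + j))"
    by (simp add: steer_entry[OF _ \<rho> ij] sum_distrib_right)
  also have "\<dots> = (\<Sum>c\<in>I. \<Sum>k<nA. \<Sum>l<nA. f c $$ (k, l) * \<rho> $$ (l * n + i, k * n + j))"
    by (simp only: sum.swap[of _ I "{..<nA}"])
  also have "\<dots> = mat_sum n (\<lambda>k. steer nA n \<rho> (f k)) I $$ (i, j)"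
    using ij by (simp add: steer_entry[OF f \<rho>])
  finally show "steer nA n \<rho> (mat_sum nA f I) $$ (i, j)
    = mat_sum n (\<lambda>k. steer nA n \<rho> (f k)) I $$ (i, j)" .
qed auto

text \<open>Each column \<open>c\<close> of a factor \<open>V\<close> of \<open>M\<close> gives a
  Kraus operator \<open>X c\<close>, the adjoint of that column tensored with Bob's identity, and
  the conditional state is the sum of the congruences of \<open>\<rho>\<close> by these
  operators.\<close>

lemma psd_steer:
  assumes M: "psd nA M" and \<rho>: "psd (nA * n) \<rho>" shows "psd n (steer nA n \<rho> M)"
proof -
  obtain V where V: "V \<in> carrier_mat nA nA" and VM: "V * mat_adjoint V = M"
    by (rule psd_factor[OF M])
  define X where "X c = mat n (nA * n) (\<lambda>(i, q). if q mod n = i then cnj (V $$ (q div n, c)) else 0)"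
    for c
  have X: "X c \<in> carrier_mat n (nA * n)" for c by (simp add: X_def)
  have row: "(\<Sum>q<nA * n. X c $$ (i, q) * F q) = (\<Sum>l<nA. cnj (V $$ (l, c)) * F (l * n + i))"
    if i: "i < n" for c i F
  proof -
    have "(\<Sum>q<nA * n. X c $$ (i, q) * F q) = (\<Sum>l<nA. \<Sum>p<n. X c $$ (i, l * n + p) * F (l * n + p))"
      by (rule sum_lessThan_mult)
    also have "\<dots> = (\<Sum>l<nA. \<Sum>p<n. if p = i then cnj (V $$ (l, c)) * F (l * n + i) else 0)"
      using i by (intro sum.cong refl) (auto simp: X_def mult_add_less)
    also have "\<dots> = (\<Sum>l<nA. cnj (V $$ (l, c)) * F (l * n + i))" using i by simp
    finally show ?thesis .
  qed
  have "steer nA n \<rho> M = mat_sum n (\<lambda>c. X c * \<rho> * mat_adjoint (X c)) {..<nA}"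
  proof (rule eq_matI)
    fix i j
    assume "i < dim_row (mat_sum n (\<lambda>c. X c * \<rho> * mat_adjoint (X c)) {..<nA})"
      "j < dim_col (mat_sum n (\<lambda>c. X c * \<rho> * mat_adjoint (X c)) {..<nA})"
    then have ij: "i < n" "j < n" by auto
    have conj: "(\<Sum>q<nA * n. F q * cnj (X c $$ (j, q))) = (\<Sum>k<nA. F (k * n + j) * V $$ (k, c))"
      for c F
    proof -
      have "(\<Sum>q<nA * n. F q * cnj (X c $$ (j, q))) = cnj (\<Sum>q<nA * n. X c $$ (j, q) * cnj (F q))"
        by (simp add: mult.commute)
      also have "\<dots> = (\<Sum>k<nA. F (k * n + j) * V $$ (k, c))"
        unfolding row[OF ij(2)] by (simp add: mult.commute)
      finally show ?thesis .
    qed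
    have X\<rho>X: "(X c * \<rho> * mat_adjoint (X c)) $$ (i, j)
        = (\<Sum>l<nA. cnj (V $$ (l, c)) * (\<Sum>k<nA. \<rho> $$ (l * n + i, k * n + j) * V $$ (k, c)))" for c
      unfolding congruence_entry[OF X psd_carrier[OF \<rho>] ij] conj mult.assoc
        sum_distrib_left[symmetric] by (simp add: row[OF ij(1)])
    have "steer nA n \<rho> M $$ (i, j)
        = (\<Sum>k<nA. \<Sum>l<nA. (\<Sum>c<nA. V $$ (k, c) * cnj (V $$ (l, c))) * \<rho> $$ (l * n + i, k * n + j))"
      unfolding steer_entry[OF psd_carrier[OF M] psd_carrier[OF \<rho>] ij]
      by (intro sum.cong refl) (simp add: mult_adjoint_entry[OF V] flip: VM del: index_mult_mat)
    also have "\<dots> = (\<Sum>k<nA. \<Sum>l<nA. \<Sum>c<nA.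
        cnj (V $$ (l, c)) * (\<rho> $$ (l * n + i, k * n + j) * V $$ (k, c)))"
      by (simp add: sum_distrib_left sum_distrib_right mult_ac)
    also have "\<dots> = (\<Sum>l<nA. \<Sum>k<nA. \<Sum>c<nA.
        cnj (V $$ (l, c)) * (\<rho> $$ (l * n + i, k * n + j) * V $$ (k, c)))"
      by (rule sum.swap)
    also have "\<dots> = (\<Sum>l<nA. \<Sum>c<nA. \<Sum>k<nA.
        cnj (V $$ (l, c)) * (\<rho> $$ (l * n + i, k * n + j) * V $$ (k, c)))"
      by (intro sum.cong refl sum.swap)
    also have "\<dots> = (\<Sum>c<nA. \<Sum>l<nA. \<Sum>k<nA.
        cnj (V $$ (l, c)) * (\<rho> $$ (l * n + i, k * n + j) * V $$ (k, c)))"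
      by (rule sum.swap)
    also have "\<dots> = mat_sum n (\<lambda>c. X c * \<rho> * mat_adjoint (X c)) {..<nA} $$ (i, j)"
      using ij by (simp add: X\<rho>X sum_distrib_left del: index_mult_mat)
    finally show "steer nA n \<rho> M $$ (i, j)
      = mat_sum n (\<lambda>c. X c * \<rho> * mat_adjoint (X c)) {..<nA} $$ (i, j)" .
  qed auto
  then show ?thesis by (simp only: psd_mat_sum psd_congruence[OF \<rho> X])
qed

section \<open>Conditional states of a pure state\<close>

text \<open>The projector onto the vector \<open>\<Sum>\<^sub>k e\<^sub>k \<otimes> V e\<^sub>k\<close>, which purifies \<open>V V\<^sup>*\<close>.\<close>

definition purification :: "nat \<Rightarrow> complex mat \<Rightarrow> complex mat" where
  "purification n V = mat (n * n) (n * n)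
     (\<lambda>(p, q). V $$ (p mod n, p div n) * cnj (V $$ (q mod n, q div n)))"

lemma psd_purification: "psd (n * n) (purification n V)"
proof -
  define X where "X = mat (n * n) 1 (\<lambda>(p, _). V $$ (p mod n, p div n))"
  have X: "X \<in> carrier_mat (n * n) 1" by (simp add: X_def)
  have "purification n V = X * mat_adjoint X"
  proof (rule eq_matI)
    fix i j assume "i < dim_row (X * mat_adjoint X)" "j < dim_col (X * mat_adjoint X)"
    then have "i < n * n" "j < n * n" by (auto simp: X_def)
    then show "purification n V $$ (i, j) = (X * mat_adjoint X) $$ (i, j)"
      by (subst mult_adjoint_entry[OF X]) (auto simp: purification_def X_def)
  qed (auto simp: purification_def X_def)
  then show ?thesis using psd_mult_adjoint[OF X] by simp
qed

lemma trace_purification: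
  assumes V: "V \<in> carrier_mat n n"
  shows "mat_trace (purification n V) = mat_trace (V * mat_adjoint V)"
proof -
  have "mat_trace (purification n V) = (\<Sum>k<n. \<Sum>i<n. V $$ (i, k) * cnj (V $$ (i, k)))"
    by (subst mat_trace_carrier[of _ "n * n"])
      (auto simp: purification_def sum_lessThan_mult mult_add_less intro!: sum.cong)
  also have "\<dots> = (\<Sum>i<n. \<Sum>k<n. V $$ (i, k) * cnj (V $$ (i, k)))" by (rule sum.swap)
  also have "\<dots> = mat_trace (V * mat_adjoint V)"
    using V by (subst mat_trace_carrier[of _ n])
      (auto simp: mult_adjoint_entry[OF V] simp del: index_mult_mat(1) intro!: sum.cong)
  finally show ?thesis .
qed

text \<open>The transpose trick: applying the transpose of \<open>N\<close> to the first factor of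
  the sum of the vectors \<open>e_k \<otimes> V e_k\<close> gives the sum of the vectors
  \<open>e_l \<otimes> V N e_l\<close>. Tracing out the first factor against the original vector
  leaves the congruence of \<open>N\<close> by \<open>V\<close>.\<close>

lemma steer_purification:
  assumes V: "V \<in> carrier_mat n n" and N: "N \<in> carrier_mat n n"
  shows "steer n n (purification n V) (transpose_mat N) = V * N * mat_adjoint V"
proof (rule eq_matI)
  fix i j assume "i < dim_row (V * N * mat_adjoint V)" "j < dim_col (V * N * mat_adjoint V)"
  then have ij: "i < n" "j < n" using V by auto
  have P: "purification n V \<in> carrier_mat (n * n) (n * n)" by (simp add: purification_def)
  have "steer n n (purification n V) (transpose_mat N) $$ (i, j)
      = (\<Sum>k<n. \<Sum>l<n. V $$ (i, l) * N $$ (l, k) * cnj (V $$ (j, k)))"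
    using ij N by (subst steer_entry[OF _ P ij])
      (auto simp: purification_def mult_add_less mult_ac intro!: sum.cong)
  also have "\<dots> = (V * N * mat_adjoint V) $$ (i, j)"
    unfolding congruence_entry[OF V N ij] by (rule sum.swap)
  finally show "steer n n (purification n V) (transpose_mat N) $$ (i, j)
    = (V * N * mat_adjoint V) $$ (i, j)" .
qed (use V in auto)

section \<open>The guessing problem\<close>

lemma mat_trace_mat_sum:
  assumes "\<And>k. k \<in> I \<Longrightarrow> f k \<in> carrier_mat n n"
  shows "mat_trace (mat_sum n f I) = (\<Sum>k\<in>I. mat_trace (f k))"
  unfolding mat_trace_sum by (intro sum.cong refl) (simp add: mat_trace_carrier[OF assms])

lemma mat_sum_eq_iff:
  assumes "A \<in> carrier_mat n n"
  shows "mat_sum n f I = A \<longleftrightarrow> (\<forall>i<n. \<forall>j<n. (\<Sum>k\<in>I. f k $$ (i, j)) = A $$ (i, j))"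
proof
  assume "mat_sum n f I = A"
  then show "\<forall>i<n. \<forall>j<n. (\<Sum>k\<in>I. f k $$ (i, j)) = A $$ (i, j)" by auto
next
  assume "\<forall>i<n. \<forall>j<n. (\<Sum>k\<in>I. f k $$ (i, j)) = A $$ (i, j)"
  then show "mat_sum n f I = A" using assms by (intro eq_matI) auto
qed

lemma assemblageD:
  assumes "assemblage m d n \<sigma>"
  shows assemblage_psd: "a < d \<Longrightarrow> x \<in> {1..m} \<Longrightarrow> psd n (\<sigma> a x)"
    and assemblage_sum_eq: "x \<in> {1..m} \<Longrightarrow> x' \<in> {1..m} \<Longrightarrow>
      mat_sum n (\<lambda>a. \<sigma> a x) {..<d} = mat_sum n (\<lambda>a. \<sigma> a x') {..<d}"
    and assemblage_trace_sum: "x \<in> {1..m} \<Longrightarrow> mat_trace (mat_sum n (\<lambda>a. \<sigma> a x) {..<d}) = 1"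
  using assms unfolding assemblage_def by blast+

lemma guess_feasibleD:
  assumes "guess_feasible m d n \<sigma> s"
  shows guess_feasible_sum: "a < d \<Longrightarrow> x \<in> {1..m} \<Longrightarrow> mat_sum n (\<lambda>e. s e a x) {..<d} = \<sigma> a x"
    and guess_feasible_sum_eq: "e < d \<Longrightarrow> x \<in> {1..m} \<Longrightarrow> x' \<in> {1..m} \<Longrightarrow>
      mat_sum n (\<lambda>a. s e a x) {..<d} = mat_sum n (\<lambda>a. s e a x') {..<d}"
    and guess_feasible_psd: "e < d \<Longrightarrow> a < d \<Longrightarrow> x \<in> {1..m} \<Longrightarrow> psd n (s e a x)"
  using assms unfolding guess_feasible_def by blast+

lemma guess_feasibleI:
  assumes "\<And>a x. a < d \<Longrightarrow> x \<in> {1..m} \<Longrightarrow> mat_sum n (\<lambda>e. s e a x) {..<d} = \<sigma> a x"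
    and "\<And>e x x'. e < d \<Longrightarrow> x \<in> {1..m} \<Longrightarrow> x' \<in> {1..m} \<Longrightarrow>
      mat_sum n (\<lambda>a. s e a x) {..<d} = mat_sum n (\<lambda>a. s e a x') {..<d}"
    and "\<And>e a x. e < d \<Longrightarrow> a < d \<Longrightarrow> x \<in> {1..m} \<Longrightarrow> psd n (s e a x)"
  shows "guess_feasible m d n \<sigma> s"
  using assms unfolding guess_feasible_def by blast

lemma assemblage_trace:
  assumes \<sigma>: "assemblage m d n \<sigma>" and x: "x \<in> {1..m}"
  shows "(\<Sum>a<d. Re (mat_trace (\<sigma> a x))) = 1"
proof -
  have "mat_trace (mat_sum n (\<lambda>a. \<sigma> a x) {..<d}) = 1" by (rule assemblage_trace_sum[OF assms])
  moreover have "mat_trace (mat_sum n (\<lambda>a. \<sigma> a x) {..<d}) = (\<Sum>a<d. mat_trace (\<sigma> a x))"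
    by (rule mat_trace_mat_sum, rule psd_carrier, rule assemblage_psd[OF \<sigma> _ x]) simp
  ultimately have "(\<Sum>a<d. mat_trace (\<sigma> a x)) = 1" by (simp only:)
  from arg_cong[OF this, of Re] show ?thesis by simp
qed

lemma guess_feasible_trace:
  assumes s: "guess_feasible m d n \<sigma> s" and a: "a < d" and x: "x \<in> {1..m}"
  shows "(\<Sum>e<d. Re (mat_trace (s e a x))) = Re (mat_trace (\<sigma> a x))"
proof -
  have "mat_trace (mat_sum n (\<lambda>e. s e a x) {..<d}) = (\<Sum>e<d. mat_trace (s e a x))"
    by (rule mat_trace_mat_sum, rule psd_carrier, rule guess_feasible_psd[OF s _ a x]) simp
  from arg_cong[OF this, of Re] show ?thesis by (simp add: guess_feasible_sum[OF s a x])
qed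

lemma guess_feasible_trace_nonneg:
  assumes "guess_feasible m d n \<sigma> s" "e < d" "a < d" "x \<in> {1..m}"
  shows "0 \<le> Re (mat_trace (s e a x))"
  using psd_trace_nonneg[OF guess_feasible_psd[OF assms]] by (simp add: less_eq_complex_def)

lemma guess_feasible_total:
  assumes \<sigma>: "assemblage m d n \<sigma>" and s: "guess_feasible m d n \<sigma> s" and x: "x \<in> {1..m}"
  shows "(\<Sum>e<d. \<Sum>a<d. Re (mat_trace (s e a x))) = 1"
  by (subst sum.swap) (simp add: guess_feasible_trace[OF s _ x] assemblage_trace[OF \<sigma> x])

text \<open>At a fixed input all traces are nonnegative and sum to 1, so each trace, and with it
  each entry, is at most 1. This confines the feasible families to a compact box.\<close>

lemma guess_feasible_entry_bound:
  assumes \<sigma>: "assemblage m d n \<sigma>" and s: "guess_feasible m d n \<sigma> s"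
    and "e < d" "a < d" and x: "x \<in> {1..m}" and "i < n" "j < n"
  shows "cmod (s e a x $$ (i, j)) \<le> 1"
proof -
  have "cmod (s e a x $$ (i, j)) \<le> Re (mat_trace (s e a x))"
    by (rule psd_entry_bound[OF guess_feasible_psd[OF s]]) (use assms in simp_all)
  also have "\<dots> \<le> (\<Sum>a<d. Re (mat_trace (s e a x)))"
    using assms guess_feasible_trace_nonneg[OF s]
    by (intro member_le_sum[of a "{..<d}" "\<lambda>a. Re (mat_trace (s e a x))"]) auto
  also have "\<dots> \<le> (\<Sum>e<d. \<Sum>a<d. Re (mat_trace (s e a x)))"
    using assms guess_feasible_trace_nonneg[OF s]
    by (intro member_le_sum[of e "{..<d}" "\<lambda>e. \<Sum>a<d. Re (mat_trace (s e a x))"] sum_nonneg) auto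
  also have "\<dots> = 1" by (rule guess_feasible_total[OF \<sigma> s x])
  finally show ?thesis .
qed

text \<open>Feasibility depends on indices in range only, so a family may be set to zero
  elsewhere.\<close>

lemma guess_feasible_cong:
  assumes eq: "\<And>e a x. e < d \<Longrightarrow> a < d \<Longrightarrow> x \<in> {1..m} \<Longrightarrow> s e a x = t e a x"
    and s: "guess_feasible m d n \<sigma> s"
  shows "guess_feasible m d n \<sigma> t"
proof -
  have e: "mat_sum n (\<lambda>e. t e a x) {..<d} = mat_sum n (\<lambda>e. s e a x) {..<d}"
    if "a < d" "x \<in> {1..m}" for a x
    unfolding mat_sum_eq_iff[OF mat_sum_carrier] using eq that by simp
  have a: "mat_sum n (\<lambda>a. t e a x) {..<d} = mat_sum n (\<lambda>a. s e a x) {..<d}"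
    if "e < d" "x \<in> {1..m}" for e x
    unfolding mat_sum_eq_iff[OF mat_sum_carrier] using eq that by simp
  show ?thesis
  proof (rule guess_feasibleI)
    fix a x assume ax: "a < d" "x \<in> {1..m}"
    show "mat_sum n (\<lambda>e. t e a x) {..<d} = \<sigma> a x"
      unfolding e[OF ax] by (rule guess_feasible_sum[OF s ax])
  next
    fix e x x' assume ex: "e < d" and x: "x \<in> {1..m}" "x' \<in> {1..m}"
    show "mat_sum n (\<lambda>a. t e a x) {..<d} = mat_sum n (\<lambda>a. t e a x') {..<d}"
      unfolding a[OF ex x(1)] a[OF ex x(2)] by (rule guess_feasible_sum_eq[OF s ex x])
  next
    fix e a x assume eax: "e < d" "a < d" "x \<in> {1..m}"
    show "psd n (t e a x)" using guess_feasible_psd[OF s eax] unfolding eq[OF eax] .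
  qed
qed

text \<open>The constant guess 0; \<open>d \<ge> 1\<close> makes 0 an outcome.\<close>

lemma guess_feasible_trivial:
  assumes \<sigma>: "assemblage m d n \<sigma>" and d: "d \<ge> 1"
  shows "guess_feasible m d n \<sigma> (\<lambda>e a x. if e = 0 then \<sigma> a x else 0\<^sub>m n n)"
proof (rule guess_feasibleI)
  fix a x assume ax: "a < d" "x \<in> {1..m}"
  have "(\<Sum>e<d. (if e = 0 then \<sigma> a x else 0\<^sub>m n n) $$ (i, j))
      = (\<Sum>e<d. if e = 0 then \<sigma> a x $$ (i, j) else 0)" if "i < n" "j < n" for i j
    using that by (intro sum.cong refl) auto
  then show "mat_sum n (\<lambda>e. if e = 0 then \<sigma> a x else 0\<^sub>m n n) {..<d} = \<sigma> a x"
    using d unfolding mat_sum_eq_iff[OF psd_carrier[OF assemblage_psd[OF \<sigma> ax]]] by simp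
next
  fix e x x' assume x: "x \<in> {1..m}" "x' \<in> {1..m}"
  show "mat_sum n (\<lambda>a. if e = 0 then \<sigma> a x else 0\<^sub>m n n) {..<d}
      = mat_sum n (\<lambda>a. if e = 0 then \<sigma> a x' else 0\<^sub>m n n) {..<d}"
    using assemblage_sum_eq[OF \<sigma> x] by (cases "e = 0") simp_all
next
  fix e a x assume "a < d" "x \<in> {1..m}"
  then show "psd n (if e = 0 then \<sigma> a x else 0\<^sub>m n n)"
    using assemblage_psd[OF \<sigma>] psd_zero by simp
qed

section \<open>Attainment of the maximum\<close>

text \<open>Index bounds do not depend on the point, so a bounded quantifier becomes an intersection
  of closed sets.\<close>

lemma closed_Collect_const_imp: "(P \<Longrightarrow> closed {x. Q x}) \<Longrightarrow> closed {x. P \<longrightarrow> Q x}"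
  by (cases P) simp_all

text \<open>Tychonoff's theorem, since the number of coordinates may be infinite. Squares serve
  better than discs because they are images of products of intervals.\<close>

lemma compact_Pi_square:
  "compact (Pi UNIV (\<lambda>_. {z. \<bar>Re z\<bar> \<le> 1 \<and> \<bar>Im z\<bar> \<le> 1}) :: ('i \<Rightarrow> complex) set)"
proof -
  have "compact ((\<lambda>(x, y). Complex x y) ` ({-1..1} \<times> {-1..1}))"
    by (intro compact_continuous_image compact_Times compact_Icc)
      (simp add: case_prod_unfold Complex_eq continuous_intros)
  also have "(\<lambda>(x, y). Complex x y) ` ({-1..1} \<times> {-1..1}) = {z. \<bar>Re z\<bar> \<le> 1 \<and> \<bar>Im z\<bar> \<le> 1}"
    by (auto simp: image_iff abs_le_iff complex_eq_iff intro!: bexI[of _ "(Re _, Im _)"])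
  finally show ?thesis
    using compactin_PiE[of "\<lambda>_::'i. euclidean :: complex topology" UNIV
        "\<lambda>_. {z. \<bar>Re z\<bar> \<le> 1 \<and> \<bar>Im z\<bar> \<le> 1}"]
    by (simp add: euclidean_product_topology PiE_UNIV_domain)
qed

text \<open>A family is encoded as a function of the five indices \<open>(e, a, x, i, j)\<close>, so
  that the product topology applies. The constraints are closed conditions on its coordinates and
  the objective is a continuous function of them.\<close>

lemma guess_max_exists:
  assumes \<sigma>: "assemblage m d n \<sigma>" and d: "d \<ge> 1" and xstar: "xstar \<in> {1..m}"
  obtains s where "guess_feasible m d n \<sigma> s"
    "\<And>t. guess_feasible m d n \<sigma> t \<Longrightarrow>
      (\<Sum>e<d. Re (mat_trace (t e e xstar))) \<le> (\<Sum>e<d. Re (mat_trace (s e e xstar)))"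
proof -
  define F :: "(nat \<times> nat \<times> nat \<times> nat \<times> nat \<Rightarrow> complex) \<Rightarrow> nat \<Rightarrow> nat \<Rightarrow> nat \<Rightarrow> complex mat"
    where "F f e a x = mat n n (\<lambda>(i, j). f (e, a, x, i, j))" for f e a x
  define obj where "obj f = (\<Sum>e<d. Re (\<Sum>i<n. f (e, e, xstar, i, i)))"
    for f :: "nat \<times> nat \<times> nat \<times> nat \<times> nat \<Rightarrow> complex"
  define C where "C = Pi UNIV (\<lambda>_. {z. \<bar>Re z\<bar> \<le> 1 \<and> \<bar>Im z\<bar> \<le> 1}) \<inter> {f. guess_feasible m d n \<sigma> (F f)}"
  have obj: "(\<Sum>e<d. Re (mat_trace (F f e e xstar))) = obj f" for f
    by (simp add: obj_def F_def mat_trace_def)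
  \<comment> \<open>Each test vector contributes one closed condition; real and imaginary parts
    express it by continuous real functions.\<close>
  have psdF: "psd n (F f e a x) \<longleftrightarrow> (\<forall>g::nat \<Rightarrow> complex.
      0 \<le> Re (\<Sum>i<n. \<Sum>j<n. cnj (g i) * f (e, a, x, i, j) * g j) \<and>
      Im (\<Sum>i<n. \<Sum>j<n. cnj (g i) * f (e, a, x, i, j) * g j) = 0)" for f e a x
  proof -
    have "(\<Sum>i<n. \<Sum>j<n. cnj (g i) * F f e a x $$ (i, j) * g j)
        = (\<Sum>i<n. \<Sum>j<n. cnj (g i) * f (e, a, x, i, j) * g j)" for g :: "nat \<Rightarrow> complex"
      by (simp add: F_def)
    moreover have "F f e a x \<in> carrier_mat n n" by (simp add: F_def)
    ultimately show ?thesis unfolding psd_iff less_eq_complex_def by (simp add: eq_commute[of 0])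
  qed
  have sumF: "mat_sum n (\<lambda>e. F f e a x) {..<d} = \<sigma> a x
      \<longleftrightarrow> (\<forall>i<n. \<forall>j<n. (\<Sum>e<d. f (e, a, x, i, j)) = \<sigma> a x $$ (i, j))"
    if "a < d" "x \<in> {1..m}" for f a x
  proof -
    show ?thesis unfolding mat_sum_eq_iff[OF psd_carrier[OF assemblage_psd[OF \<sigma> that]]]
      by (simp add: F_def)
  qed
  have sumF': "mat_sum n (\<lambda>a. F f e a x) {..<d} = mat_sum n (\<lambda>a. F f e a x') {..<d}
      \<longleftrightarrow> (\<forall>i<n. \<forall>j<n. (\<Sum>a<d. f (e, a, x, i, j)) = (\<Sum>a<d. f (e, a, x', i, j)))" for f e x x'
    unfolding mat_sum_eq_iff[OF mat_sum_carrier] by (simp add: F_def)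
  have feasible_iff: "guess_feasible m d n \<sigma> (F f) \<longleftrightarrow>
     (\<forall>a. a < d \<longrightarrow> (\<forall>x. x \<in> {1..m} \<longrightarrow> (\<forall>i. i < n \<longrightarrow> (\<forall>j. j < n \<longrightarrow>
        (\<Sum>e<d. f (e, a, x, i, j)) = \<sigma> a x $$ (i, j))))) \<and>
     (\<forall>e. e < d \<longrightarrow> (\<forall>x. x \<in> {1..m} \<longrightarrow> (\<forall>x'. x' \<in> {1..m} \<longrightarrow> (\<forall>i. i < n \<longrightarrow> (\<forall>j. j < n \<longrightarrow>
        (\<Sum>a<d. f (e, a, x, i, j)) = (\<Sum>a<d. f (e, a, x', i, j))))))) \<and>
     (\<forall>e. e < d \<longrightarrow> (\<forall>a. a < d \<longrightarrow> (\<forall>x. x \<in> {1..m} \<longrightarrow> (\<forall>g::nat \<Rightarrow> complex.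
        0 \<le> Re (\<Sum>i<n. \<Sum>j<n. cnj (g i) * f (e, a, x, i, j) * g j) \<and>
        Im (\<Sum>i<n. \<Sum>j<n. cnj (g i) * f (e, a, x, i, j) * g j) = 0))))" for f
    unfolding guess_feasible_def psdF sumF' using sumF unfolding Ball_def by meson
  note [continuous_intros] = continuous_on_product_coordinates
  have "closed {f. guess_feasible m d n \<sigma> (F f)}"
    unfolding feasible_iff
    by (intro closed_Collect_conj closed_Collect_all closed_Collect_const_imp
        closed_Collect_eq closed_Collect_le continuous_intros)
  then have "compact C" unfolding C_def by (intro compact_Int_closed compact_Pi_square)
  have lift: "\<exists>f\<in>C. obj f = (\<Sum>e<d. Re (mat_trace (t e e xstar)))"
    if t: "guess_feasible m d n \<sigma> t" for t
  proof -
    \<comment> \<open>The value 0 outside the index ranges keeps those coordinates inside the square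
      too.\<close>
    define f where "f = (\<lambda>(e, a, x, i, j).
      if e < d \<and> a < d \<and> x \<in> {1..m} \<and> i < n \<and> j < n then t e a x $$ (i, j) else 0)"
    have Ft: "F f e a x = t e a x" if "e < d" "a < d" "x \<in> {1..m}" for e a x
    proof -
      have "t e a x \<in> carrier_mat n n"
        by (rule psd_carrier[OF guess_feasible_psd[OF t that]])
      then show ?thesis using that by (intro eq_matI) (auto simp: F_def f_def)
    qed
    have "cmod (f q) \<le> 1" for q
      using guess_feasible_entry_bound[OF \<sigma> t] by (cases q) (simp add: f_def)
    then have "\<bar>Re (f q)\<bar> \<le> 1 \<and> \<bar>Im (f q)\<bar> \<le> 1" for q
      using abs_Re_le_cmod abs_Im_le_cmod order_trans by blast
    moreover have "guess_feasible m d n \<sigma> (F f)"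
      by (rule guess_feasible_cong[OF _ t]) (simp add: Ft)
    ultimately have "f \<in> C" by (simp add: C_def)
    moreover have "obj f = (\<Sum>e<d. Re (mat_trace (t e e xstar)))"
      unfolding obj[symmetric] using xstar by (simp add: Ft)
    ultimately show ?thesis by blast
  qed
  have "C \<noteq> {}" using lift[OF guess_feasible_trivial[OF \<sigma> d]] by blast
  moreover have "continuous_on C obj"
    unfolding obj_def by (intro continuous_intros continuous_on_subset[OF continuous_on_product_coordinates]) auto
  ultimately obtain f where f: "f \<in> C" and max: "\<And>g. g \<in> C \<Longrightarrow> obj g \<le> obj f"
    using continuous_attains_sup[OF \<open>compact C\<close>] by blast
  show thesis
  proof (rule that)
    show "guess_feasible m d n \<sigma> (F f)" using f by (simp add: C_def)
    fix t assume "guess_feasible m d n \<sigma> t"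
    then show "(\<Sum>e<d. Re (mat_trace (t e e xstar))) \<le> (\<Sum>e<d. Re (mat_trace (F f e e xstar)))"
      using lift max unfolding obj by metis
  qed
qed

text \<open>A maximizer is what gives \<open>GREATEST\<close> its intended value. No value exceeds
  1, because the terms with \<open>a\<close> different from \<open>e\<close> that the objective
  omits have nonnegative trace; so staying below 1 means that 1 is not reached.\<close>

lemma guess_prob_less_one_iff:
  assumes \<sigma>: "assemblage m d n \<sigma>" and d: "d \<ge> 1" and xstar: "xstar \<in> {1..m}"
  shows "guess_prob m d n \<sigma> xstar < 1 \<longleftrightarrow>
    \<not> (\<exists>s. guess_feasible m d n \<sigma> s \<and> (\<Sum>e<d. Re (mat_trace (s e e xstar))) = 1)"
proof -
  obtain s where s: "guess_feasible m d n \<sigma> s"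
    and max: "\<And>t. guess_feasible m d n \<sigma> t \<Longrightarrow>
      (\<Sum>e<d. Re (mat_trace (t e e xstar))) \<le> (\<Sum>e<d. Re (mat_trace (s e e xstar)))"
    by (rule guess_max_exists[OF \<sigma> d xstar]) blast
  have P: "guess_prob m d n \<sigma> xstar = (\<Sum>e<d. Re (mat_trace (s e e xstar)))"
    unfolding guess_prob_def by (rule Greatest_equality) (use s max in auto)
  have le_1: "(\<Sum>e<d. Re (mat_trace (t e e xstar))) \<le> 1" if t: "guess_feasible m d n \<sigma> t" for t
  proof -
    have "(\<Sum>e<d. Re (mat_trace (t e e xstar))) \<le> (\<Sum>e<d. \<Sum>a<d. Re (mat_trace (t e a xstar)))"
    proof (rule sum_mono)
      fix e assume "e \<in> {..<d}"
      then show "Re (mat_trace (t e e xstar)) \<le> (\<Sum>a<d. Re (mat_trace (t e a xstar)))"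
        using guess_feasible_trace_nonneg[OF t _ _ xstar]
        by (intro member_le_sum[of e "{..<d}" "\<lambda>a. Re (mat_trace (t e a xstar))"]) auto
    qed
    then show ?thesis by (simp add: guess_feasible_total[OF \<sigma> t xstar])
  qed
  show ?thesis
  proof
    assume "guess_prob m d n \<sigma> xstar < 1"
    then show "\<not> (\<exists>s. guess_feasible m d n \<sigma> s \<and> (\<Sum>e<d. Re (mat_trace (s e e xstar))) = 1)"
      using max unfolding P by (metis not_le)
  next
    assume "\<not> (\<exists>s. guess_feasible m d n \<sigma> s \<and> (\<Sum>e<d. Re (mat_trace (s e e xstar))) = 1)"
    then show "guess_prob m d n \<sigma> xstar < 1" using le_1[OF s] s unfolding P by force
  qed
qed

text \<open>The diagonal terms already use up the total trace 1 at \<open>xstar\<close>. The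
  remaining traces are nonnegative, hence zero, and a positive semidefinite operator of trace zero
  vanishes.\<close>

lemma perfect_guess_off_diagonal:
  assumes \<sigma>: "assemblage m d n \<sigma>" and s: "guess_feasible m d n \<sigma> s" and xstar: "xstar \<in> {1..m}"
    and 1: "(\<Sum>e<d. Re (mat_trace (s e e xstar))) = 1"
    and ea: "e < d" "a < d" "a \<noteq> e"
  shows "s e a xstar = 0\<^sub>m n n"
proof -
  note nonneg = guess_feasible_trace_nonneg[OF s _ _ xstar]
  define r where "r e = (\<Sum>a\<in>{..<d} - {e}. Re (mat_trace (s e a xstar)))" for e
  have split: "(\<Sum>a<d. Re (mat_trace (s e a xstar))) = Re (mat_trace (s e e xstar)) + r e" if "e < d" for e
    unfolding r_def using that by (intro sum.remove) simp_all
  have "(\<Sum>e<d. r e) = 0"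
    using guess_feasible_total[OF \<sigma> s xstar] 1 by (simp add: split sum.distrib)
  moreover have r_nonneg: "0 \<le> r e" if "e < d" for e unfolding r_def using nonneg that by (intro sum_nonneg) auto
  ultimately have "r e = 0" using sum_nonneg_0[of "{..<d}" r e] ea by simp
  then have "Re (mat_trace (s e a xstar)) = 0"
    unfolding r_def using nonneg ea by (subst (asm) sum_nonneg_eq_0_iff) auto
  moreover have psd: "psd n (s e a xstar)" by (rule guess_feasible_psd[OF s ea(1,2) xstar])
  ultimately have "mat_trace (s e a xstar) = 0"
    using psd_trace_nonneg[OF psd] by (simp add: less_eq_complex_def complex_eq_iff)
  then show ?thesis by (rule psd_trace_zero[OF psd])
qed

section \<open>Pairs of compatible measurements\<close>

lemma psd_add:
  assumes A: "psd n A" and B: "psd n B" shows "psd n (A + B)"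
proof -
  have "A + B = mat_sum n (\<lambda>k. if k then A else B) (UNIV :: bool set)"
    using psd_carrier[OF A] psd_carrier[OF B] by (intro eq_matI) (auto simp: UNIV_bool)
  moreover have "psd n (mat_sum n (\<lambda>k. if k then A else B) (UNIV :: bool set))"
    by (rule psd_mat_sum) (simp add: A B)
  ultimately show ?thesis by (simp only:)
qed

lemma psd_smult:
  assumes A: "psd n A" and c: "0 \<le> c" shows "psd n (complex_of_real c \<cdot>\<^sub>m A)"
  unfolding psd_iff
proof (intro conjI allI)
  note Ac = psd_carrier[OF A]
  show "complex_of_real c \<cdot>\<^sub>m A \<in> carrier_mat n n" using Ac by simp
  fix f :: "nat \<Rightarrow> complex"
  have "(\<Sum>i<n. \<Sum>j<n. cnj (f i) * (complex_of_real c \<cdot>\<^sub>m A) $$ (i, j) * f j)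
      = (\<Sum>i<n. \<Sum>j<n. complex_of_real c * (cnj (f i) * A $$ (i, j) * f j))"
    using Ac by (intro sum.cong refl) simp
  also have "\<dots> = complex_of_real c * (\<Sum>i<n. \<Sum>j<n. cnj (f i) * A $$ (i, j) * f j)"
    by (simp only: sum_distrib_left)
  also have "0 \<le> \<dots>"
  proof (rule mult_nonneg_nonneg)
    show "0 \<le> complex_of_real c" using c by (simp add: less_eq_complex_def)
    show "0 \<le> (\<Sum>i<n. \<Sum>j<n. cnj (f i) * A $$ (i, j) * f j)" using A unfolding psd_iff by blast
  qed
  finally show "0 \<le> (\<Sum>i<n. \<Sum>j<n. cnj (f i) * (complex_of_real c \<cdot>\<^sub>m A) $$ (i, j) * f j)" .
qed

lemma povm_psd: "povm n I M \<Longrightarrow> a \<in> I \<Longrightarrow> psd n (M a)"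
  and povm_sum: "povm n I M \<Longrightarrow> mat_sum n M I = 1\<^sub>m n"
  by (simp_all add: povm_def)

text \<open>Passes between a parent POVM with classical post-processing and a joint POVM on pairs of
  outcomes with prescribed marginals. The second form is the one that matches refinements of an
  assemblage.\<close>

lemma compatible_pair_iff:
  assumes xy: "x \<noteq> y" and Mx: "povm n {..<d} (\<lambda>a. M a x)" and My: "povm n {..<d} (\<lambda>a. M a y)"
  shows "compatible d n M {x, y} \<longleftrightarrow>
    (\<exists>H. (\<forall>e<d. \<forall>a<d. psd n (H e a)) \<and>
      (\<forall>e<d. mat_sum n (\<lambda>a. H e a) {..<d} = M e x) \<and>
      (\<forall>a<d. mat_sum n (\<lambda>e. H e a) {..<d} = M a y))"
    (is "?lhs \<longleftrightarrow> (\<exists>H. ?joint H)")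
proof
  assume ?lhs
  then obtain L :: nat and G and p :: "nat \<Rightarrow> nat \<Rightarrow> nat \<Rightarrow> real" where G: "povm n {..<L} G"
    and p: "\<forall>z\<in>{x, y}. \<forall>l<L. (\<forall>a<d. 0 \<le> p a z l) \<and> (\<Sum>a<d. p a z l) = 1"
    and M: "\<forall>z\<in>{x, y}. \<forall>a<d. M a z = mat_sum n (\<lambda>l. complex_of_real (p a z l) \<cdot>\<^sub>m G l) {..<L}"
    unfolding compatible_def by (elim exE conjE)
  note M = M[rule_format]
  \<comment> \<open>Given \<open>l\<close>, the two outcomes are drawn independently; summing over
    one of them removes its factor.\<close>
  define H where "H e a = mat_sum n (\<lambda>l. complex_of_real (p e x l * p a y l) \<cdot>\<^sub>m G l) {..<L}" for e a
  have Gc: "G l \<in> carrier_mat n n" if "l < L" for l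
    using povm_psd[OF G] that by (intro psd_carrier) simp
  have entry: "(\<Sum>l<L. (complex_of_real (q l) \<cdot>\<^sub>m G l) $$ (i, j)) = (\<Sum>l<L. complex_of_real (q l) * G l $$ (i, j))"
    if "i < n" "j < n" for q i j
    using carrier_matD[OF Gc] that by (intro sum.cong refl) simp
  have one: "(\<Sum>a<d. complex_of_real (p a z l)) = 1" if "z \<in> {x, y}" "l < L" for z l
    using p[rule_format, OF that] by (simp flip: of_real_sum)
  have "?joint H"
  proof (intro conjI allI impI)
    fix e a assume "e < d" "a < d"
    then show "psd n (H e a)"
      unfolding H_def using p by (intro psd_mat_sum psd_smult povm_psd[OF G] mult_nonneg_nonneg) auto
  next
    fix e assume e: "e < d"
    have "(\<Sum>a<d. H e a $$ (i, j)) = M e x $$ (i, j)" if ij: "i < n" "j < n" for i j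
    proof -
      have "(\<Sum>a<d. H e a $$ (i, j))
          = (\<Sum>l<L. (\<Sum>a<d. complex_of_real (p a y l)) * (complex_of_real (p e x l) * G l $$ (i, j)))"
        unfolding H_def index_mat_sum[OF ij] entry[OF ij]
        by (subst sum.swap) (simp add: sum_distrib_right sum_distrib_left mult_ac)
      also have "\<dots> = M e x $$ (i, j)" unfolding M[OF insertI1 e] index_mat_sum[OF ij] entry[OF ij]
        by (intro sum.cong refl) (simp add: one)
      finally show ?thesis .
    qed
    then show "mat_sum n (\<lambda>a. H e a) {..<d} = M e x"
      using povm_psd[OF Mx] e by (subst mat_sum_eq_iff[OF psd_carrier]) auto
  next
    fix a assume a: "a < d"
    have "(\<Sum>e<d. H e a $$ (i, j)) = M a y $$ (i, j)" if ij: "i < n" "j < n" for i j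
    proof -
      have "(\<Sum>e<d. H e a $$ (i, j))
          = (\<Sum>l<L. (\<Sum>e<d. complex_of_real (p e x l)) * (complex_of_real (p a y l) * G l $$ (i, j)))"
        unfolding H_def index_mat_sum[OF ij] entry[OF ij]
        by (subst sum.swap) (simp add: sum_distrib_right sum_distrib_left mult_ac)
      also have "\<dots> = M a y $$ (i, j)"
        unfolding M[OF insertI2[OF singletonI] a] index_mat_sum[OF ij] entry[OF ij]
        by (intro sum.cong refl) (simp add: one)
      finally show ?thesis .
    qed
    then show "mat_sum n (\<lambda>e. H e a) {..<d} = M a y"
      using povm_psd[OF My] a by (subst mat_sum_eq_iff[OF psd_carrier]) auto
  qed
  then show "\<exists>H. ?joint H" by blast
next
  assume "\<exists>H. ?joint H"
  then obtain H where psd: "\<And>e a. e < d \<Longrightarrow> a < d \<Longrightarrow> psd n (H e a)"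
    and Hx: "\<And>e. e < d \<Longrightarrow> mat_sum n (\<lambda>a. H e a) {..<d} = M e x"
    and Hy: "\<And>a. a < d \<Longrightarrow> mat_sum n (\<lambda>e. H e a) {..<d} = M a y" by blast
  \<comment> \<open>The label \<open>e * d + a\<close> stands for the pair
    \<open>(e, a)\<close>.\<close>
  define G where "G l = H (l div d) (l mod d)" for l
  \<comment> \<open>The response is deterministic: \<open>x\<close> reads the first component of the
    pair, \<open>y\<close> the second. This is consistent because the two inputs differ.\<close>
  define p where "p a z l = (of_bool (a = (if z = x then l div d else l mod d)) :: real)" for a z l :: nat
  have dm: "l div d < d" "l mod d < d" if "l < d * d" for l
  proof -
    have "0 < d" using that by (cases d) auto
    then show "l div d < d" "l mod d < d" using that by (simp_all add: less_mult_imp_div_less)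
  qed
  have G_idx: "G (e * d + a) = H e a" if "a < d" for e a using that by (simp add: G_def)
  have p_idx: "p b x (e * d + a) = of_bool (b = e)" "p b y (e * d + a) = of_bool (b = a)"
    if "a < d" for b e a
    using that xy by (simp_all add: p_def)
  have Gc: "G l \<in> carrier_mat n n" if "l < d * d" for l
    unfolding G_def by (rule psd_carrier[OF psd[OF dm[OF that]]])
  have povm: "povm n {..<d * d} G"
    unfolding povm_def
  proof (intro conjI ballI)
    fix l assume "l \<in> {..<d * d}"
    then show "psd n (G l)" unfolding G_def by (intro psd dm) simp_all
  next
    have "(\<Sum>l<d * d. G l $$ (i, j)) = 1\<^sub>m n $$ (i, j)" if ij: "i < n" "j < n" for i j
    proof -
      have "(\<Sum>l<d * d. G l $$ (i, j)) = (\<Sum>e<d. \<Sum>a<d. H e a $$ (i, j))"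
        unfolding sum_lessThan_mult by (intro sum.cong refl) (simp add: G_idx)
      also have "\<dots> = (\<Sum>e<d. M e x $$ (i, j))"
        by (intro sum.cong refl) (use ij in \<open>simp flip: Hx\<close>)
      also have "\<dots> = mat_sum n (\<lambda>a. M a x) {..<d} $$ (i, j)" using ij by simp
      also have "\<dots> = 1\<^sub>m n $$ (i, j)" unfolding povm_sum[OF Mx] ..
      finally show ?thesis .
    qed
    then show "mat_sum n G {..<d * d} = 1\<^sub>m n" by (subst mat_sum_eq_iff) auto
  qed
  have dist: "(\<forall>a<d. 0 \<le> p a z l) \<and> (\<Sum>a<d. p a z l) = 1" if "l < d * d" for z l
    using dm[OF that] by (simp add: p_def of_bool_def)
  have mix: "(\<Sum>l<d * d. (complex_of_real (p b z l) \<cdot>\<^sub>m G l) $$ (i, j))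
      = (\<Sum>e<d. \<Sum>a<d. complex_of_real (p b z (e * d + a)) * H e a $$ (i, j))"
    if ij: "i < n" "j < n" for b z i j
  proof -
    have "(\<Sum>l<d * d. (complex_of_real (p b z l) \<cdot>\<^sub>m G l) $$ (i, j))
        = (\<Sum>l<d * d. complex_of_real (p b z l) * G l $$ (i, j))"
      using carrier_matD[OF Gc] ij by (intro sum.cong refl) simp
    also have "\<dots> = (\<Sum>e<d. \<Sum>a<d. complex_of_real (p b z (e * d + a)) * H e a $$ (i, j))"
      unfolding sum_lessThan_mult by (intro sum.cong refl) (simp add: G_idx)
    finally show ?thesis .
  qed
  have "M b z = mat_sum n (\<lambda>l. complex_of_real (p b z l) \<cdot>\<^sub>m G l) {..<d * d}"
    if z: "z \<in> {x, y}" and b: "b < d" for z b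
  proof -
    have "(\<Sum>l<d * d. (complex_of_real (p b z l) \<cdot>\<^sub>m G l) $$ (i, j)) = M b z $$ (i, j)"
      if ij: "i < n" "j < n" for i j
    proof (cases "z = x")
      case True
      have "(\<Sum>e<d. \<Sum>a<d. complex_of_real (p b x (e * d + a)) * H e a $$ (i, j))
          = (\<Sum>e<d. if b = e then \<Sum>a<d. H e a $$ (i, j) else 0)"
        by (intro sum.cong refl) (simp add: p_idx)
      also have "\<dots> = (\<Sum>a<d. H b a $$ (i, j))" using b by simp
      also have "\<dots> = M b x $$ (i, j)" using ij unfolding Hx[OF b, symmetric] by simp
      finally show ?thesis unfolding mix[OF ij] True .
    next
      case False
      then have zy: "z = y" using z by simp
      have "(\<Sum>e<d. \<Sum>a<d. complex_of_real (p b y (e * d + a)) * H e a $$ (i, j))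
          = (\<Sum>e<d. \<Sum>a<d. if b = a then H e a $$ (i, j) else 0)"
        by (intro sum.cong refl) (simp add: p_idx)
      also have "\<dots> = (\<Sum>e<d. H e b $$ (i, j))" using b by simp
      also have "\<dots> = M b y $$ (i, j)" using ij unfolding Hy[OF b, symmetric] by simp
      finally show ?thesis unfolding mix[OF ij] zy .
    qed
    moreover have "psd n (M b z)" using z b povm_psd[OF Mx] povm_psd[OF My] by auto
    ultimately show ?thesis by (subst mat_sum_eq_iff[OF psd_carrier, THEN iffD2]) auto
  qed
  with povm dist show ?lhs unfolding compatible_def by blast
qed

section \<open>Perfect guessing\<close>

lemma perfect_guess_of_star:
  assumes \<sigma>: "\<sigma> \<in> star_assemblages m d n xstar" and xstar: "xstar \<in> {1..m}"
  obtains s where "guess_feasible m d n \<sigma> s" "(\<Sum>e<d. Re (mat_trace (s e e xstar))) = 1"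
proof -
  obtain nA \<rho> M where as: "assemblage m d n \<sigma>" and \<rho>: "psd (nA * n) \<rho>"
    and povm: "\<And>x. x \<in> {1..m} \<Longrightarrow> povm nA {..<d} (\<lambda>a. M a x)"
    and star: "star_graph m xstar \<subseteq> compat_structure m d nA M"
    and steer: "\<And>a x. a < d \<Longrightarrow> x \<in> {1..m} \<Longrightarrow> \<sigma> a x = steer nA n \<rho> (M a x)"
    using \<sigma> unfolding star_assemblages_def steer_def by blast
  have M: "psd nA (M a x)" if "a < d" "x \<in> {1..m}" for a x
    using povm_psd[OF povm] that by simp
  define joint where "joint x H \<longleftrightarrow> (\<forall>e<d. \<forall>a<d. psd nA (H e a)) \<and>
      (\<forall>e<d. mat_sum nA (\<lambda>a. H e a) {..<d} = M e xstar) \<and>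
      (\<forall>a<d. mat_sum nA (\<lambda>e. H e a) {..<d} = M a x)" for x and H :: "nat \<Rightarrow> nat \<Rightarrow> complex mat"
  \<comment> \<open>The edges supply joint POVMs for the inputs other than the centre. At the centre
    itself the diagonal one is prescribed, as it makes the guess agree with the outcome.\<close>
  have "\<exists>H. joint x H \<and> (x = xstar \<longrightarrow> (\<forall>e<d. H e e = M e xstar))" if x: "x \<in> {1..m}" for x
  proof (cases "x = xstar")
    case True
    define H where "H e a = (if a = e then M e xstar else 0\<^sub>m nA nA)" for e a
    have "(\<Sum>a<d. H e a $$ (i, j)) = M e xstar $$ (i, j)" "(\<Sum>a<d. H a e $$ (i, j)) = M e xstar $$ (i, j)"
      if "e < d" "i < nA" "j < nA" for e i j
    proof -
      have "(\<Sum>a<d. H e a $$ (i, j)) = (\<Sum>a<d. if a = e then M e xstar $$ (i, j) else 0)"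
        "(\<Sum>a<d. H a e $$ (i, j)) = (\<Sum>a<d. if a = e then M e xstar $$ (i, j) else 0)"
        using that by (intro sum.cong refl; force simp: H_def)+
      then show "(\<Sum>a<d. H e a $$ (i, j)) = M e xstar $$ (i, j)"
        "(\<Sum>a<d. H a e $$ (i, j)) = M e xstar $$ (i, j)" using that by simp_all
    qed
    then have "mat_sum nA (\<lambda>a. H e a) {..<d} = M e xstar" "mat_sum nA (\<lambda>a. H a e) {..<d} = M e xstar"
      if "e < d" for e
      using that by (subst mat_sum_eq_iff[OF psd_carrier[OF M[OF that xstar]]]; blast)+
    moreover have "psd nA (H e a)" if "e < d" for e a
      using M[OF that xstar] psd_zero by (simp add: H_def)
    ultimately have "joint x H" unfolding joint_def True by blast
    then show ?thesis by (auto simp: H_def)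
  next
    case False
    then have "{xstar, x} \<in> compat_structure m d nA M" using star x by (auto simp: star_graph_def)
    then have "compatible d nA M {xstar, x}" by (simp add: compat_structure_def)
    then show ?thesis
      using False unfolding compatible_pair_iff[OF False[symmetric] povm[OF xstar] povm[OF x]] joint_def
      by blast
  qed
  then obtain H where H: "\<And>x. x \<in> {1..m} \<Longrightarrow> joint x (H x)"
    and Hstar: "\<And>e. e < d \<Longrightarrow> H xstar e e = M e xstar"
    using xstar by metis
  have psd: "psd nA (H x e a)" if "e < d" "a < d" "x \<in> {1..m}" for x e a
    using H[OF that(3)] that unfolding joint_def by blast
  have row: "mat_sum nA (\<lambda>a. H x e a) {..<d} = M e xstar" if "e < d" "x \<in> {1..m}" for x e
    using H[OF that(2)] that unfolding joint_def by blast
  have col: "mat_sum nA (\<lambda>e. H x e a) {..<d} = M a x" if "a < d" "x \<in> {1..m}" for x a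
    using H[OF that(2)] that unfolding joint_def by blast
  define s where "s e a x = steer nA n \<rho> (H x e a)" for e a x
  \<comment> \<open>The first marginal belongs to the centre and is the same for all
    \<open>x\<close>, which yields the no-signalling constraint for each \<open>e\<close>.\<close>
  have row': "mat_sum n (\<lambda>a. s e a x) {..<d} = \<sigma> e xstar" if ex: "e < d" "x \<in> {1..m}" for e x
  proof -
    have "mat_sum n (\<lambda>a. s e a x) {..<d} = steer nA n \<rho> (mat_sum nA (\<lambda>a. H x e a) {..<d})"
      unfolding s_def
      by (rule steer_mat_sum[symmetric]) (use ex in \<open>simp_all add: psd_carrier[OF psd] psd_carrier[OF \<rho>]\<close>)
    then show ?thesis unfolding row[OF ex] steer[OF ex(1) xstar] .
  qed
  have col': "mat_sum n (\<lambda>e. s e a x) {..<d} = \<sigma> a x" if ax: "a < d" "x \<in> {1..m}" for a x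
  proof -
    have "mat_sum n (\<lambda>e. s e a x) {..<d} = steer nA n \<rho> (mat_sum nA (\<lambda>e. H x e a) {..<d})"
      unfolding s_def
      by (rule steer_mat_sum[symmetric]) (use ax in \<open>simp_all add: psd_carrier[OF psd] psd_carrier[OF \<rho>]\<close>)
    then show ?thesis unfolding col[OF ax] steer[OF ax] .
  qed
  show thesis
  proof (rule that)
    show "guess_feasible m d n \<sigma> s"
    proof (rule guess_feasibleI)
      fix e a x assume "e < d" "a < d" "x \<in> {1..m}"
      then show "psd n (s e a x)" unfolding s_def by (intro psd_steer psd \<rho>)
    next
      fix a x assume "a < d" "x \<in> {1..m}"
      then show "mat_sum n (\<lambda>e. s e a x) {..<d} = \<sigma> a x" by (rule col')
    next
      fix e x x' assume e: "e < d" and x: "x \<in> {1..m}" "x' \<in> {1..m}"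
      show "mat_sum n (\<lambda>a. s e a x) {..<d} = mat_sum n (\<lambda>a. s e a x') {..<d}"
        unfolding row'[OF e x(1)] row'[OF e x(2)] ..
    qed
    have "s e e xstar = \<sigma> e xstar" if "e < d" for e
      unfolding s_def Hstar[OF that] steer[OF that xstar] ..
    then show "(\<Sum>e<d. Re (mat_trace (s e e xstar))) = 1"
      using assemblage_trace[OF as xstar] by simp
  qed
qed

lemma mat_sum_add_point:
  assumes "c \<in> I" "finite I" and T: "T \<in> carrier_mat n n" and f: "\<And>k. k \<in> I \<Longrightarrow> f k \<in> carrier_mat n n"
  shows "mat_sum n (\<lambda>k. f k + (if k = c then T else 0\<^sub>m n n)) I = mat_sum n f I + T"
proof (rule eq_matI)
  fix i j assume "i < dim_row (mat_sum n f I + T)" "j < dim_col (mat_sum n f I + T)"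
  then have ij: "i < n" "j < n" using T by auto
  have "mat_sum n (\<lambda>k. f k + (if k = c then T else 0\<^sub>m n n)) I $$ (i, j)
      = (\<Sum>k\<in>I. f k $$ (i, j) + (if k = c then T $$ (i, j) else 0))"
    unfolding index_mat_sum[OF ij] using T ij by (intro sum.cong refl) auto
  also have "\<dots> = (mat_sum n f I + T) $$ (i, j)"
    using assms ij by (simp add: sum.distrib)
  finally show "mat_sum n (\<lambda>k. f k + (if k = c then T else 0\<^sub>m n n)) I $$ (i, j) = (mat_sum n f I + T) $$ (i, j)" .
qed (use T in auto)

lemma mat_sum_transpose:
  assumes "\<And>k. k \<in> I \<Longrightarrow> f k \<in> carrier_mat n n"
  shows "mat_sum n (\<lambda>k. transpose_mat (f k)) I = transpose_mat (mat_sum n f I)"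
proof (rule eq_matI)
  fix i j assume "i < dim_row (transpose_mat (mat_sum n f I))" "j < dim_col (transpose_mat (mat_sum n f I))"
  then have ij: "i < n" "j < n" by auto
  have "(\<Sum>k\<in>I. transpose_mat (f k) $$ (i, j)) = (\<Sum>k\<in>I. f k $$ (j, i))"
    using carrier_matD[OF assms] ij by (intro sum.cong refl) simp
  then show "mat_sum n (\<lambda>k. transpose_mat (f k)) I $$ (i, j) = transpose_mat (mat_sum n f I) $$ (i, j)"
    using ij by simp
qed auto

text \<open>The operator \<open>s e a x\<close> is pulled back along the purification of Bob's reduced state to an
  element of a joint POVM for the inputs \<open>xstar\<close> and \<open>x\<close>. The part \<open>T\<close> of the identity outside the
  support of that state is assigned to outcome \<open>0\<close>.\<close>

lemma star_of_perfect_guess: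
  assumes \<sigma>: "assemblage m d n \<sigma>" and d: "d \<ge> 1" and xstar: "xstar \<in> {1..m}"
    and s: "guess_feasible m d n \<sigma> s"
    and off: "\<And>e a. e < d \<Longrightarrow> a < d \<Longrightarrow> a \<noteq> e \<Longrightarrow> s e a xstar = 0\<^sub>m n n"
  shows "\<sigma> \<in> star_assemblages m d n xstar"
proof -
  define R where "R = mat_sum n (\<lambda>a. \<sigma> a xstar) {..<d}"
  have R_eq: "mat_sum n (\<lambda>a. \<sigma> a x) {..<d} = R" if "x \<in> {1..m}" for x
    unfolding R_def by (rule assemblage_sum_eq[OF \<sigma> that xstar])
  have R: "psd n R" unfolding R_def by (rule psd_mat_sum) (simp add: assemblage_psd[OF \<sigma> _ xstar])
  obtain V W where V: "V \<in> carrier_mat n n" and W: "W \<in> carrier_mat n n" and VR: "V * mat_adjoint V = R"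
    and T0: "psd n (1\<^sub>m n - W * R * mat_adjoint W)"
    and VWS: "\<And>S. psd n S \<Longrightarrow> psd n (R - S) \<Longrightarrow> V * (W * S * mat_adjoint W) * mat_adjoint V = S"
    by (rule psd_factor_inverse[OF R]) blast
  define K where "K S = W * S * mat_adjoint W" for S
  define T where "T = 1\<^sub>m n - K R"
  have T: "psd n T" using T0 by (simp only: T_def K_def)
  have K: "psd n (K S)" if "psd n S" for S unfolding K_def by (rule psd_congruence[OF that W])
  note Kc = psd_carrier[OF K] and Tc = psd_carrier[OF T]
  have K_sum: "mat_sum n (\<lambda>k. K (f k)) I = K (mat_sum n f I)"
    if "\<And>k. k \<in> I \<Longrightarrow> f k \<in> carrier_mat n n" for f and I :: "nat set"
    unfolding K_def by (rule congruence_mat_sum[OF W that, symmetric])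
  \<comment> \<open>The boolean argument describes every placement of \<open>T\<close> by one rule:
    summing over an index that is required to be 0 leaves the rest of the condition.\<close>
  define P where "P c = (if c then T else 0\<^sub>m n n)" for c
  have P: "psd n (P c)" for c using T psd_zero by (simp add: P_def)
  note Pc = psd_carrier[OF P]
  have P_sum: "mat_sum n (\<lambda>k. f k + P (k = 0 \<and> c)) {..<d} = mat_sum n f {..<d} + P c"
    if f: "\<And>k. k < d \<Longrightarrow> f k \<in> carrier_mat n n" for f c
  proof (cases c)
    case True
    then show ?thesis unfolding P_def using mat_sum_add_point[of 0 "{..<d}" T n f] Tc f d by simp
  next
    case False
    then show ?thesis unfolding P_def
      using mat_sum_add_point[of 0 "{..<d}" "0\<^sub>m n n" n f] f d by simp
  qed
  \<comment> \<open>Both terms of the difference equal \<open>R\<close>, the first because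
    \<open>V\<close> factors \<open>R\<close>, the second because \<open>V\<close> undoes
    \<open>K\<close> on \<open>R\<close>. Hence \<open>T\<close> is invisible to Bob.\<close>
  have V_zero: "V * T * mat_adjoint V = 0\<^sub>m n n"
  proof -
    have "V * T * mat_adjoint V = V * 1\<^sub>m n * mat_adjoint V - V * K R * mat_adjoint V"
      unfolding T_def using V Kc[OF R]
      by (simp add: mult_minus_distrib_mat[of _ n n _ n] minus_mult_distrib_mat[of _ n n _ _ n])
    also have "V * K R * mat_adjoint V = R"
      unfolding K_def by (rule VWS[OF R]) (use psd_zero psd_carrier[OF R] in simp)
    also have "V * 1\<^sub>m n * mat_adjoint V = R" using V VR by simp
    finally show ?thesis using psd_carrier[OF R] by simp
  qed
  have V_P: "V * P c * mat_adjoint V = 0\<^sub>m n n" for c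
    using V V_zero by (simp add: P_def)
  have \<sigma>_psd: "psd n (\<sigma> a x)" if "a < d" "x \<in> {1..m}" for a x
    by (rule assemblage_psd[OF \<sigma> that])
  \<comment> \<open>The difference is the sum of the other outcomes, so \<open>\<sigma> a x\<close>
    lies below \<open>R\<close>, as \<open>VWS\<close> demands.\<close>
  have R_minus: "psd n (R - \<sigma> a x)" if ax: "a < d" "x \<in> {1..m}" for a x
  proof -
    have "R - \<sigma> a x = mat_sum n (\<lambda>a. \<sigma> a x) ({..<d} - {a})"
      unfolding R_eq[OF ax(2), symmetric] using psd_carrier[OF \<sigma>_psd[OF ax]] ax
      by (intro eq_matI) (auto simp: sum_diff1)
    moreover have "psd n (mat_sum n (\<lambda>a. \<sigma> a x) ({..<d} - {a}))"
      by (rule psd_mat_sum) (use ax \<sigma>_psd in simp)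
    ultimately show ?thesis by (simp only:)
  qed
  \<comment> \<open>Built from \<open>\<sigma>\<close> alone, so that all edges share the
    measurement of the centre; \<open>s\<close> enters only through the joint POVMs.\<close>
  define N where "N a x = K (\<sigma> a x) + P (a = 0)" for a x
  define M where "M a x = transpose_mat (N a x)" for a x
  have N_psd: "psd n (N a x)" if "a < d" "x \<in> {1..m}" for a x
    unfolding N_def by (intro psd_add K P \<sigma>_psd that)
  have N_sum: "mat_sum n (\<lambda>a. N a x) {..<d} = 1\<^sub>m n" if x: "x \<in> {1..m}" for x
  proof -
    have "mat_sum n (\<lambda>a. N a x) {..<d} = mat_sum n (\<lambda>a. K (\<sigma> a x)) {..<d} + P True"
      using P_sum[of "\<lambda>a. K (\<sigma> a x)" True] Kc[OF \<sigma>_psd[OF _ x]] by (simp add: N_def)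
    also have "mat_sum n (\<lambda>a. K (\<sigma> a x)) {..<d} = K R"
      unfolding R_eq[OF x, symmetric] by (rule K_sum) (simp add: psd_carrier[OF \<sigma>_psd[OF _ x]])
    also have "K R + P True = 1\<^sub>m n" using Kc[OF R] by (intro eq_matI) (auto simp: P_def T_def)
    finally show ?thesis .
  qed
  have povm: "povm n {..<d} (\<lambda>a. M a x)" if x: "x \<in> {1..m}" for x
    unfolding povm_def
  proof (intro conjI ballI)
    fix a assume "a \<in> {..<d}"
    then show "psd n (M a x)" unfolding M_def using x by (intro psd_transpose N_psd) auto
  next
    have "mat_sum n (\<lambda>a. M a x) {..<d} = transpose_mat (mat_sum n (\<lambda>a. N a x) {..<d})"
      unfolding M_def by (rule mat_sum_transpose) (simp add: psd_carrier[OF N_psd[OF _ x]])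
    then show "mat_sum n (\<lambda>a. M a x) {..<d} = 1\<^sub>m n" unfolding N_sum[OF x] by simp
  qed
  have steer: "\<sigma> a x = steer n n (purification n V) (M a x)" if ax: "a < d" "x \<in> {1..m}" for a x
  proof -
    note \<sigma>c = psd_carrier[OF \<sigma>_psd[OF ax]] and Kc' = Kc[OF \<sigma>_psd[OF ax]]
    have "steer n n (purification n V) (M a x) = V * N a x * mat_adjoint V"
      unfolding M_def by (rule steer_purification[OF V psd_carrier[OF N_psd[OF ax]]])
    also have "\<dots> = V * K (\<sigma> a x) * mat_adjoint V + V * P (a = 0) * mat_adjoint V"
      unfolding N_def mult_add_distrib_mat[OF V Kc' Pc]
      by (rule add_mult_distrib_mat[OF mult_carrier_mat[OF V Kc'] mult_carrier_mat[OF V Pc]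
            mat_adjoint_carrier[OF V]])
    also have "V * K (\<sigma> a x) * mat_adjoint V = \<sigma> a x"
      unfolding K_def by (rule VWS[OF \<sigma>_psd[OF ax] R_minus[OF ax]])
    also have "\<sigma> a x + V * P (a = 0) * mat_adjoint V = \<sigma> a x" unfolding V_P using \<sigma>c by simp
    finally show ?thesis ..
  qed
  have s_psd: "psd n (s e a x)" if "e < d" "a < d" "x \<in> {1..m}" for e a x
    by (rule guess_feasible_psd[OF s that])
  \<comment> \<open>At \<open>xstar\<close> the sums of \<open>s\<close> over the outcome and over
    the guess both collapse to the diagonal term \<open>s e e xstar\<close>. The second is
    \<open>\<sigma> e xstar\<close>, and no-signalling transports the first to every other
    input.\<close>
  have s_row: "mat_sum n (\<lambda>a. s e a x) {..<d} = \<sigma> e xstar" if ex: "e < d" "x \<in> {1..m}" for e x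
  proof -
    have sum_if: "(\<Sum>k<d. f k $$ (i, j)) = f e $$ (i, j)"
      if "\<And>k. k < d \<Longrightarrow> k \<noteq> e \<Longrightarrow> f k = 0\<^sub>m n n" "i < n" "j < n" for f :: "nat \<Rightarrow> complex mat" and i j
    proof -
      have "(\<Sum>k<d. f k $$ (i, j)) = (\<Sum>k<d. if k = e then f e $$ (i, j) else 0)"
        using that by (intro sum.cong refl) auto
      then show ?thesis using ex by simp
    qed
    note c = psd_carrier[OF s_psd[OF ex(1) ex(1) xstar]]
    have "mat_sum n (\<lambda>a. s e a x) {..<d} = mat_sum n (\<lambda>a. s e a xstar) {..<d}"
      by (rule guess_feasible_sum_eq[OF s ex xstar])
    also have "\<dots> = s e e xstar"
      unfolding mat_sum_eq_iff[OF c] using sum_if[of "\<lambda>a. s e a xstar"] off[OF ex(1)] by blast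
    also have "\<dots> = mat_sum n (\<lambda>k. s k e xstar) {..<d}"
      by (rule sym) (unfold mat_sum_eq_iff[OF c], use sum_if[of "\<lambda>k. s k e xstar"] off[OF _ ex(1)] in blast)
    also have "\<dots> = \<sigma> e xstar" by (rule guess_feasible_sum[OF s ex(1) xstar])
    finally show ?thesis .
  qed
  have compat: "compatible d n M {xstar, x}" if x: "x \<in> {1..m}" and ne: "x \<noteq> xstar" for x
  proof -
    \<comment> \<open>Placed at the pair (0, 0) only, \<open>T\<close> occurs once in row 0 and once
      in column 0, exactly as in the two measurements given by \<open>N\<close>.\<close>
    define H where "H e a = K (s e a x) + P (e = 0 \<and> a = 0)" for e a
    have H_psd: "psd n (H e a)" if "e < d" "a < d" for e a
      unfolding H_def by (intro psd_add K P s_psd that x)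
    have row: "mat_sum n (\<lambda>a. H e a) {..<d} = N e xstar" if e: "e < d" for e
    proof -
      have "mat_sum n (\<lambda>a. H e a) {..<d} = mat_sum n (\<lambda>a. K (s e a x)) {..<d} + P (e = 0)"
        using P_sum[of "\<lambda>a. K (s e a x)" "e = 0"] Kc[OF s_psd[OF e _ x]] by (simp add: H_def conj_commute)
      also have "mat_sum n (\<lambda>a. K (s e a x)) {..<d} = K (\<sigma> e xstar)"
        unfolding s_row[OF e x, symmetric] by (rule K_sum) (simp add: psd_carrier[OF s_psd[OF e _ x]])
      finally show ?thesis unfolding N_def .
    qed
    have col: "mat_sum n (\<lambda>e. H e a) {..<d} = N a x" if a: "a < d" for a
    proof -
      have "mat_sum n (\<lambda>e. H e a) {..<d} = mat_sum n (\<lambda>e. K (s e a x)) {..<d} + P (a = 0)"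
        using P_sum[of "\<lambda>e. K (s e a x)" "a = 0"] Kc[OF s_psd[OF _ a x]] by (simp add: H_def)
      also have "mat_sum n (\<lambda>e. K (s e a x)) {..<d} = K (\<sigma> a x)"
        unfolding guess_feasible_sum[OF s a x, symmetric]
        by (rule K_sum) (simp add: psd_carrier[OF s_psd[OF _ a x]])
      finally show ?thesis unfolding N_def .
    qed
    have "mat_sum n (\<lambda>a. transpose_mat (H e a)) {..<d} = M e xstar" if "e < d" for e
      unfolding M_def row[OF that, symmetric]
      by (rule mat_sum_transpose) (simp add: psd_carrier[OF H_psd[OF that]])
    moreover have "mat_sum n (\<lambda>e. transpose_mat (H e a)) {..<d} = M a x" if "a < d" for a
      unfolding M_def col[OF that, symmetric]
      by (rule mat_sum_transpose) (simp add: psd_carrier[OF H_psd[OF _ that]])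
    ultimately show ?thesis
      unfolding compatible_pair_iff[OF ne[symmetric] povm[OF xstar] povm[OF x]]
      using psd_transpose[OF H_psd] by (intro exI[of _ "\<lambda>e a. transpose_mat (H e a)"]) blast
  qed
  have "mat_trace (purification n V) = 1"
    unfolding trace_purification[OF V] VR R_def by (rule assemblage_trace_sum[OF \<sigma> xstar])
  moreover have "star_graph m xstar \<subseteq> compat_structure m d n M"
    using compat xstar by (auto simp: star_graph_def compat_structure_def)
  ultimately show ?thesis
    using \<sigma> psd_purification[of n V] povm steer unfolding star_assemblages_def steer_def by blast
qed

theorem proposition1:
  fixes m d n xstar :: nat and \<sigma>_obs :: "nat \<Rightarrow> nat \<Rightarrow> complex mat"
  assumes "m \<ge> 1" and "d \<ge> 1"
    and "assemblage m d n \<sigma>_obs"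
    and "xstar \<in> {1..m}"
  shows "guess_prob m d n \<sigma>_obs xstar < 1 \<longleftrightarrow> \<sigma>_obs \<notin> star_assemblages m d n xstar"
proof -
  have "(\<exists>s. guess_feasible m d n \<sigma>_obs s \<and> (\<Sum>e<d. Re (mat_trace (s e e xstar))) = 1)
    \<longleftrightarrow> \<sigma>_obs \<in> star_assemblages m d n xstar"
  proof
    assume "\<exists>s. guess_feasible m d n \<sigma>_obs s \<and> (\<Sum>e<d. Re (mat_trace (s e e xstar))) = 1"
    then obtain s where s: "guess_feasible m d n \<sigma>_obs s"
      and 1: "(\<Sum>e<d. Re (mat_trace (s e e xstar))) = 1" by blast
    show "\<sigma>_obs \<in> star_assemblages m d n xstar"
      by (rule star_of_perfect_guess[OF assms(3,2,4) s perfect_guess_off_diagonal[OF assms(3) s assms(4) 1]])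
  next
    assume "\<sigma>_obs \<in> star_assemblages m d n xstar"
    then show "\<exists>s. guess_feasible m d n \<sigma>_obs s \<and> (\<Sum>e<d. Re (mat_trace (s e e xstar))) = 1"
      by (rule perfect_guess_of_star[OF _ assms(4)]) blast
  qed
  then show ?thesis unfolding guess_prob_less_one_iff[OF assms(3,2,4)] by blast
qed

end
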